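(* Let $\mathcal{P}$ be a single machine scheduling problem (of the kind described in the context) in which $w_j=1$ for every job $j$. If $\textsc{Min-Max}~\mathcal{P}$ with $K\ge2$ scenarios is NP-hard and hard to approximate within $\rho>1$, then: (1) for each constant $\alpha\in(0,1)$, $\textsc{Min-VaR}_\alpha~\mathcal{P}$ with $K+1$ scenarios is NP-hard and hard to approximate within $\rho$; (2) for each constant $\alpha\in(0,1)$, $\textsc{Min-CVaR}_\alpha~\mathcal{P}$ with $K+1$ scenarios is NP-hard.
   Context: A single machine scheduling instance: a set $J$ of $n$ jobs, possibly with precedence constraints; a schedule $\pi$ is a permutation of $J$ respecting the precedence constraints, processed without idle time from time 0; $\Pi$ is the set of feasible schedules. Job $j$ has nonnegative processing time $p_j$, due date $d_j$ and weight $w_j$; $C_j(\pi)$ is its completion time, $T_j(\pi)=\max\{0,C_j(\pi)-d_j\}$, $U_j(\pi)=1$ if $C_j(\pi)>d_j$ and $0$ otherwise. The problem $\mathcal{P}$ (Graham notation $1|\beta|\gamma$) has as cost function one of the total flow time $\sum C_j$, total tardiness $\sum T_j$, maximum tardiness $\max_j T_j$, number of late jobs $\sum U_j$ (or their weighted versions). Uncertainty: a scenario set $\mathcal{U}=\{\xi_1,\dots,\xi_K\}$ is part of the input; each scenario $\xi$ specifies processing times $p_j(\xi)$ and due dates $d_j(\xi)$, with probability ${\rm Pr}[\xi]>0$, $\sum_i{\rm Pr}[\xi_i]=1$; $f(\pi,\xi)$ is the cost of $\pi$ under $\xi$; ${\rm F}(\pi)$ is the random variable equal to $f(\pi,\xi_i)$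 with probability ${\rm Pr}[\xi_i]$. $\textsc{Min-Max}~\mathcal{P}$ minimizes $\max_{i}f(\pi,\xi_i)$; $\textsc{Min-VaR}_\alpha~\mathcal{P}$ minimizes $\mathbf{VaR}_\alpha[{\rm F}(\pi)]$ with $\mathbf{VaR}_\alpha[\mathrm{Y}]=\inf\{t:{\rm Pr}[\mathrm{Y}\le t]\ge\alpha\}$; $\textsc{Min-CVaR}_\alpha~\mathcal{P}$ minimizes $\mathbf{CVaR}_\alpha[{\rm F}(\pi)]$ with $\mathbf{CVaR}_\alpha[\mathrm{Y}]=\inf_{\gamma\in\mathbb{R}}\{\gamma+\frac{1}{1-\alpha}\mathbf{E}[(\mathrm{Y}-\gamma)^+]\}$. "Hard to approximate within $\rho$" means no polynomial-time algorithm returns schedules with objective at most $\rho$ times the optimum, unless P=NP. *)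

theory Defs
  imports
    "HOL-Probability.Probability"
    "HOL-Combinatorics.Multiset_Permutations"
    "HOL-Computational_Algebra.Polynomial"
begin

section \<open>Polynomial time, NP, and hardness of optimization problems\<close>

text \<open>
  Complexity is measured on structured programs over finitely many stacks of symbols from a fixed
  finite alphabet. A stack is one half of a Turing tape and the primitive operations are unit-cost,
  local ones, so these programs and multi-tape Turing machines simulate each other with polynomial
  overhead.
\<close>

datatype sym = Digit bool | Sep | Open | Close

type_synonym word = "sym list"
type_synonym state = "nat \<Rightarrow> word"

definition top_of :: "state \<Rightarrow> nat \<Rightarrow> sym option" where
  "top_of s X = (case s X of [] \<Rightarrow> None | a # _ \<Rightarrow> Some a)"

datatype prog =
    Skip
  | Push nat sym
  | Pop nat
  | Query nat
  | Seq prog prog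
  | Branch nat "sym option set" prog prog
  | Loop nat "sym option set" prog

text \<open>
  \<open>exec g c s t s'\<close>: with oracle \<open>g\<close>, program \<open>c\<close> started in \<open>s\<close> halts in \<open>s'\<close> after time \<open>t\<close>.
  A query is charged for the length of the question and of the answer.
\<close>

inductive exec :: "(word \<Rightarrow> word) \<Rightarrow> prog \<Rightarrow> state \<Rightarrow> nat \<Rightarrow> state \<Rightarrow> bool"
  for g :: "word \<Rightarrow> word" where
  Skip: "exec g Skip s 1 s"
| Push: "exec g (Push X a) s 1 (s(X := a # s X))"
| Pop: "exec g (Pop X) s 1 (s(X := tl (s X)))"
| Query: "exec g (Query X) s (1 + length (s X) + length (g (s X))) (s(X := g (s X)))"
| Seq: "exec g c1 s t1 s1 \<Longrightarrow> exec g c2 s1 t2 s2 \<Longrightarrow> exec g (Seq c1 c2) s (t1 + t2) s2"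
| BranchT: "top_of s X \<in> A \<Longrightarrow> exec g c1 s t s' \<Longrightarrow> exec g (Branch X A c1 c2) s (1 + t) s'"
| BranchF: "top_of s X \<notin> A \<Longrightarrow> exec g c2 s t s' \<Longrightarrow> exec g (Branch X A c1 c2) s (1 + t) s'"
| LoopF: "top_of s X \<notin> A \<Longrightarrow> exec g (Loop X A c) s 1 s"
| LoopT: "top_of s X \<in> A \<Longrightarrow> exec g c s t1 s1 \<Longrightarrow> exec g (Loop X A c) s1 t2 s2 \<Longrightarrow>
    exec g (Loop X A c) s (1 + t1 + t2) s2"

primrec query_free :: "prog \<Rightarrow> bool" where
  "query_free Skip = True"
| "query_free (Push X a) = True"
| "query_free (Pop X) = True"
| "query_free (Query X) = False"
| "query_free (Seq c1 c2) = (query_free c1 \<and> query_free c2)"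
| "query_free (Branch X A c1 c2) = (query_free c1 \<and> query_free c2)"
| "query_free (Loop X A c) = query_free c"

definition init :: "word list \<Rightarrow> state" where
  "init xs = (\<lambda>i. if i < length xs then xs ! i else [])"

text \<open>Inputs are placed on the first stacks; the output is read off stack 0.\<close>

definition outputs :: "(word \<Rightarrow> word) \<Rightarrow> prog \<Rightarrow> word list \<Rightarrow> nat \<Rightarrow> word \<Rightarrow> bool" where
  "outputs g c xs b y \<longleftrightarrow> (\<exists>t s. exec g c (init xs) t s \<and> t \<le> b \<and> s 0 = y)"

definition no_oracle :: "word \<Rightarrow> word" where
  "no_oracle = (\<lambda>_. [])"

definition verdict :: "bool \<Rightarrow> word" where
  "verdict b = [Digit b]"

definition class_P :: "word set set" where
  "class_P = {L. \<exists>c (p :: nat poly). query_free c \<and>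
     (\<forall>x. outputs no_oracle c [x] (poly p (length x)) (verdict (x \<in> L)))}"

definition class_NP :: "word set set" where
  "class_NP = {L. \<exists>c (p :: nat poly) (q :: nat poly) V. query_free c \<and>
     (\<forall>x y. outputs no_oracle c [x, y] (poly p (length x + length y)) (verdict (V x y))) \<and>
     (\<forall>x. x \<in> L \<longleftrightarrow> (\<exists>y. length y \<le> poly q (length x) \<and> V x y))}"

record ('i, 's) min_problem =
  instances :: "'i set"
  solutions :: "'i \<Rightarrow> 's set"
  objective :: "'i \<Rightarrow> 's \<Rightarrow> real"
  enc_instance :: "'i \<Rightarrow> word"
  enc_solution :: "'s \<Rightarrow> word"

definition opt_value :: "('i, 's) min_problem \<Rightarrow> 'i \<Rightarrow> real" where
  "opt_value A I = Min (objective A I ` solutions A I)"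

text \<open>The search problems of finding an optimal, resp. a \<open>\<rho>\<close>-approximate, solution, as relations
  between input and output words.\<close>

definition optimal_answer :: "('i, 's) min_problem \<Rightarrow> word \<Rightarrow> word \<Rightarrow> bool" where
  "optimal_answer A x y \<longleftrightarrow> (\<exists>I \<in> instances A. \<exists>S \<in> solutions A I.
     x = enc_instance A I \<and> y = enc_solution A S \<and> objective A I S = opt_value A I)"

definition approx_answer :: "real \<Rightarrow> ('i, 's) min_problem \<Rightarrow> word \<Rightarrow> word \<Rightarrow> bool" where
  "approx_answer \<rho> A x y \<longleftrightarrow> (\<exists>I \<in> instances A. \<exists>S \<in> solutions A I.
     x = enc_instance A I \<and> y = enc_solution A S \<and> objective A I S \<le> \<rho> * opt_value A I)"

definition solves :: "(word \<Rightarrow> word) \<Rightarrow> (word \<Rightarrow> word \<Rightarrow> bool) \<Rightarrow> bool" where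
  "solves g R \<longleftrightarrow> (\<forall>x. (\<exists>y. R x y) \<longrightarrow> R x (g x))"

text \<open>NP-hardness of an optimization (search) problem in the sense of Garey and Johnson: every
  language in NP is polynomial-time Turing reducible to it.\<close>

definition NP_hard :: "('i, 's) min_problem \<Rightarrow> bool" where
  "NP_hard A \<longleftrightarrow> (\<forall>L \<in> class_NP. \<exists>c (p :: nat poly). \<forall>g. solves g (optimal_answer A) \<longrightarrow>
     (\<forall>x. outputs g c [x] (poly p (length x)) (verdict (x \<in> L))))"

definition polytime_solvable :: "(word \<Rightarrow> word \<Rightarrow> bool) \<Rightarrow> bool" where
  "polytime_solvable R \<longleftrightarrow> (\<exists>c (p :: nat poly). query_free c \<and>
     (\<forall>x. (\<exists>y. R x y) \<longrightarrow> (\<exists>y. outputs no_oracle c [x] (poly p (length x)) y \<and> R x y)))"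

definition hard_to_approximate :: "real \<Rightarrow> ('i, 's) min_problem \<Rightarrow> bool" where
  "hard_to_approximate \<rho> A \<longleftrightarrow>
     (class_P \<noteq> class_NP \<longrightarrow> \<not> polytime_solvable (approx_answer \<rho> A))"


section \<open>Single machine scheduling\<close>

datatype criterion = FlowTime | Tardiness | MaxTardiness | LateJobs

text \<open>The jobs are \<open>0, \<dots>, n - 1\<close> and a schedule is the list of jobs in processing order.\<close>

definition completion :: "(nat \<Rightarrow> real) \<Rightarrow> nat list \<Rightarrow> nat \<Rightarrow> real" where
  "completion p \<pi> j = sum_list (map p (takeWhile (\<lambda>i. i \<noteq> j) \<pi>)) + p j"

definition tardiness :: "(nat \<Rightarrow> real) \<Rightarrow> (nat \<Rightarrow> real) \<Rightarrow> nat list \<Rightarrow> nat \<Rightarrow> real" where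
  "tardiness p d \<pi> j = max 0 (completion p \<pi> j - d j)"

definition late :: "(nat \<Rightarrow> real) \<Rightarrow> (nat \<Rightarrow> real) \<Rightarrow> nat list \<Rightarrow> nat \<Rightarrow> real" where
  "late p d \<pi> j = (if completion p \<pi> j > d j then 1 else 0)"

fun cost :: "criterion \<Rightarrow> (nat \<Rightarrow> real) \<Rightarrow> (nat \<Rightarrow> real) \<Rightarrow> (nat \<Rightarrow> real) \<Rightarrow> nat list \<Rightarrow> real" where
  "cost FlowTime w p d \<pi> = (\<Sum>j\<in>set \<pi>. w j * completion p \<pi> j)"
| "cost Tardiness w p d \<pi> = (\<Sum>j\<in>set \<pi>. w j * tardiness p d \<pi> j)"
| "cost MaxTardiness w p d \<pi> = Max ((\<lambda>j. w j * tardiness p d \<pi> j) ` set \<pi>)"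
| "cost LateJobs w p d \<pi> = (\<Sum>j\<in>set \<pi>. w j * late p d \<pi> j)"

text \<open>The job \<open>j\<close> has processing time \<open>fst (\<xi> ! j)\<close> and due date \<open>snd (\<xi> ! j)\<close> under scenario \<open>\<xi>\<close>.\<close>

type_synonym scenario = "(rat \<times> rat) list"

definition ptime :: "scenario \<Rightarrow> nat \<Rightarrow> real" where
  "ptime \<xi> j = real_of_rat (fst (\<xi> ! j))"

definition ddate :: "scenario \<Rightarrow> nat \<Rightarrow> real" where
  "ddate \<xi> j = real_of_rat (snd (\<xi> ! j))"

text \<open>
  The \<open>\<beta>\<close> field of a problem \<open>1|\<beta>|\<gamma>\<close>: \<open>prec_class n R\<close> tells which precedence relations on \<open>n\<close> jobs
  are admitted (only the empty one, chains, trees, arbitrary ones, \<dots>), and \<open>unit_times\<close> whether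
  \<open>p\<^sub>j = 1\<close> is imposed.
\<close>

record problem =
  prec_class :: "nat \<Rightarrow> (nat \<times> nat) set \<Rightarrow> bool"
  unit_times :: bool
  criterion_of :: criterion

record uncertain_instance =
  njobs :: nat
  precs :: "(nat \<times> nat) list"
  scenarios :: "scenario list"

definition valid_scenario :: "problem \<Rightarrow> nat \<Rightarrow> scenario \<Rightarrow> bool" where
  "valid_scenario P n \<xi> \<longleftrightarrow> length \<xi> = n \<and>
     (\<forall>(p, d) \<in> set \<xi>. 0 \<le> p \<and> 0 \<le> d \<and> (unit_times P \<longrightarrow> p = 1))"

definition uncertain_instances :: "problem \<Rightarrow> nat \<Rightarrow> uncertain_instance set" where
  "uncertain_instances P K = {I. njobs I > 0 \<and>
     set (precs I) \<subseteq> {..<njobs I} \<times> {..<njobs I} \<and> acyclic (set (precs I)) \<and>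
     prec_class P (njobs I) (set (precs I)) \<and>
     length (scenarios I) = K \<and> (\<forall>\<xi> \<in> set (scenarios I). valid_scenario P (njobs I) \<xi>)}"

definition schedules :: "uncertain_instance \<Rightarrow> nat list set" where
  "schedules I = {\<pi> \<in> permutations_of_set {..<njobs I}.
     \<forall>a < njobs I. \<forall>b < njobs I. (\<pi> ! a, \<pi> ! b) \<in> set (precs I) \<longrightarrow> a < b}"

definition unit_weight_cost :: "problem \<Rightarrow> nat list \<Rightarrow> scenario \<Rightarrow> real" where
  "unit_weight_cost P \<pi> \<xi> = cost (criterion_of P) (\<lambda>_. 1) (ptime \<xi>) (ddate \<xi>) \<pi>"


section \<open>Encodings\<close>

fun bits :: "nat \<Rightarrow> bool list" where
  "bits n = (if n = 0 then [] else odd n # bits (n div 2))"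

declare bits.simps [simp del]

definition enc_nat :: "nat \<Rightarrow> word" where
  "enc_nat n = map Digit (bits n) @ [Sep]"

text \<open>Only nonnegative rationals occur, so no sign is recorded.\<close>

definition enc_rat :: "rat \<Rightarrow> word" where
  "enc_rat r = enc_nat (nat (fst (quotient_of r))) @ enc_nat (nat (snd (quotient_of r)))"

definition enc_list :: "('a \<Rightarrow> word) \<Rightarrow> 'a list \<Rightarrow> word" where
  "enc_list e xs = Open # concat (map e xs) @ [Close]"

text \<open>The number of jobs is written in unary; every scenario lists all jobs anyway.\<close>

definition enc_uncertain :: "uncertain_instance \<Rightarrow> word" where
  "enc_uncertain I = replicate (njobs I) (Digit True) @ [Sep] @
     enc_list (\<lambda>(i, j). enc_nat i @ enc_nat j) (precs I) @
     enc_list (enc_list (\<lambda>(p, d). enc_rat p @ enc_rat d)) (scenarios I)"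


section \<open>The min-max, value at risk and conditional value at risk problems\<close>

definition Min_Max :: "problem \<Rightarrow> nat \<Rightarrow> (uncertain_instance, nat list) min_problem" where
  "Min_Max P K = \<lparr>
     instances = uncertain_instances P K,
     solutions = schedules,
     objective = (\<lambda>I \<pi>. Max (unit_weight_cost P \<pi> ` set (scenarios I))),
     enc_instance = enc_uncertain,
     enc_solution = enc_list enc_nat\<rparr>"

definition VaR :: "real \<Rightarrow> real pmf \<Rightarrow> real" where
  "VaR \<alpha> Y = Inf {t. measure_pmf.prob Y {..t} \<ge> \<alpha>}"

definition CVaR :: "real \<Rightarrow> real pmf \<Rightarrow> real" where
  "CVaR \<alpha> Y = (INF \<gamma>. \<gamma> + 1 / (1 - \<alpha>) * measure_pmf.expectation Y (\<lambda>y. max 0 (y - \<gamma>)))"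

text \<open>Instances with scenario probabilities, the \<open>i\<close>-th probability belonging to the \<open>i\<close>-th
  scenario.\<close>

type_synonym stochastic_instance = "uncertain_instance \<times> rat list"

definition stochastic_instances :: "problem \<Rightarrow> nat \<Rightarrow> stochastic_instance set" where
  "stochastic_instances P K = {(I, q). I \<in> uncertain_instances P K \<and>
     length q = K \<and> (\<forall>r \<in> set q. r > 0) \<and> sum_list q = 1}"

definition random_cost :: "problem \<Rightarrow> stochastic_instance \<Rightarrow> nat list \<Rightarrow> real pmf" where
  "random_cost P J \<pi> = pmf_of_list
     (zip (map (unit_weight_cost P \<pi>) (scenarios (fst J))) (map real_of_rat (snd J)))"

definition enc_stochastic :: "stochastic_instance \<Rightarrow> word" where
  "enc_stochastic J = enc_list enc_rat (snd J) @ enc_uncertain (fst J)"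

definition Min_Risk ::
  "(real pmf \<Rightarrow> real) \<Rightarrow> problem \<Rightarrow> nat \<Rightarrow> (stochastic_instance, nat list) min_problem" where
  "Min_Risk \<phi> P K = \<lparr>
     instances = stochastic_instances P K,
     solutions = schedules \<circ> fst,
     objective = (\<lambda>J \<pi>. \<phi> (random_cost P J \<pi>)),
     enc_instance = enc_stochastic,
     enc_solution = enc_list enc_nat\<rparr>"

definition Min_VaR :: "real \<Rightarrow> problem \<Rightarrow> nat \<Rightarrow> (stochastic_instance, nat list) min_problem" where
  "Min_VaR \<alpha> = Min_Risk (VaR \<alpha>)"

definition Min_CVaR :: "real \<Rightarrow> problem \<Rightarrow> nat \<Rightarrow> (stochastic_instance, nat list) min_problem" where
  "Min_CVaR \<alpha> = Min_Risk (CVaR \<alpha>)"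

end

theory Submission imports Defs begin

text \<open>
  Fix a rational \<open>a\<close> with \<open>a - a / K < \<alpha> < a < 1\<close>. Given a min-max instance, add one scenario of
  probability \<open>1 - a\<close> in which all due dates are \<open>0\<close> and all processing times equal a common upper
  bound of the given ones, and give each old scenario the probability \<open>a / K\<close>. The cost \<open>M\<close> of the new
  scenario dominates the old costs, and it does not depend on the schedule since all jobs look alike.
  The worst outcomes of total mass \<open>1 - \<alpha>\<close> therefore consist of the new scenario and a part of the
  worst old one. Hence the value at risk equals the maximum \<open>m\<close> of the old costs, and the conditional
  value at risk equals \<open>((1 - a) M + (a - \<alpha>) m) / (1 - \<alpha>)\<close>, so that optimal schedules, and for the
  value at risk also approximation ratios, are preserved.

  On words, the reduction prepends a constant word and inserts the new scenario before the final
  bracket. As processing time it uses \<open>1\<close> if unit times are imposed, and otherwise a power of two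
  whose exponent is the length of the part of the input that follows the unary number of jobs.
\<close>

section \<open>Running stack programs\<close>

text \<open>Exact times depend on the data in detail; an upper bound can be rounded up and still
  composes.\<close>

definition runs :: "(word \<Rightarrow> word) \<Rightarrow> prog \<Rightarrow> state \<Rightarrow> nat \<Rightarrow> state \<Rightarrow> bool" where
  "runs g c s b s' \<longleftrightarrow> (\<exists>t\<le>b. exec g c s t s')"

lemma outputs_iff_runs: "outputs g c xs b y \<longleftrightarrow> (\<exists>s. runs g c (init xs) b s \<and> s 0 = y)"
  by (auto simp: outputs_def runs_def)

lemma runs_mono: "runs g c s b s' \<Longrightarrow> b \<le> b' \<Longrightarrow> runs g c s b' s'"
  unfolding runs_def using order_trans by blast

lemma runs_Skip: "runs g Skip s 1 s"
  unfolding runs_def using exec.Skip by blast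

lemma runs_Push: "runs g (Push X a) s 1 (s(X := a # s X))"
  unfolding runs_def using exec.Push by blast

lemma runs_Pop: "runs g (Pop X) s 1 (s(X := tl (s X)))"
  unfolding runs_def using exec.Pop by blast

lemma runs_Query: "runs g (Query X) s (1 + length (s X) + length (g (s X))) (s(X := g (s X)))"
  unfolding runs_def using exec.Query by blast

lemma runs_Seq:
  "runs g c1 s b1 s1 \<Longrightarrow> runs g c2 s1 b2 s2 \<Longrightarrow> runs g (Seq c1 c2) s (b1 + b2) s2"
  unfolding runs_def by (meson add_mono exec.Seq)

lemma runs_BranchT:
  "top_of s X \<in> A \<Longrightarrow> runs g c1 s b s' \<Longrightarrow> runs g (Branch X A c1 c2) s (1 + b) s'"
  unfolding runs_def by (meson add_left_mono exec.BranchT)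

lemma runs_BranchF:
  "top_of s X \<notin> A \<Longrightarrow> runs g c2 s b s' \<Longrightarrow> runs g (Branch X A c1 c2) s (1 + b) s'"
  unfolding runs_def by (meson add_left_mono exec.BranchF)

lemma runs_LoopF: "top_of s X \<notin> A \<Longrightarrow> runs g (Loop X A c) s 1 s"
  unfolding runs_def using exec.LoopF by blast

lemma runs_LoopT:
  assumes "top_of s X \<in> A" "runs g c s b1 s1" "runs g (Loop X A c) s1 b2 s2"
  shows "runs g (Loop X A c) s (1 + b1 + b2) s2"
proof -
  obtain t1 t2 where "t1 \<le> b1" "exec g c s t1 s1" "t2 \<le> b2" "exec g (Loop X A c) s1 t2 s2"
    using assms(2,3) by (auto simp: runs_def)
  then have "exec g (Loop X A c) s (1 + t1 + t2) s2" "1 + t1 + t2 \<le> 1 + b1 + b2"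
    using exec.LoopT[OF assms(1)] by auto
  then show ?thesis unfolding runs_def by blast
qed

text \<open>Loop rule for a trace \<open>\<sigma>\<close> in closed form: each round pays
  \<open>b\<close> and one test, and the failing test at the end pays 1. All loops below are
  verified this way.\<close>

lemma runs_iterate:
  assumes "\<And>i. i < n \<Longrightarrow> top_of (\<sigma> i) X \<in> A" "top_of (\<sigma> n) X \<notin> A"
    and "\<And>i. i < n \<Longrightarrow> runs g c (\<sigma> i) b (\<sigma> (Suc i))"
  shows "runs g (Loop X A c) (\<sigma> 0) (n * (b + 1) + 1) (\<sigma> n)"
  using assms
proof (induction n arbitrary: \<sigma>)
  case 0
  then show ?case by (simp add: runs_LoopF[simplified])
next
  case (Suc n)
  have "runs g (Loop X A c) (\<sigma> (Suc 0)) (n * (b + 1) + 1) (\<sigma> (Suc n))"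
    using Suc.IH[of "\<lambda>i. \<sigma> (Suc i)"] Suc.prems by simp
  then have "runs g (Loop X A c) (\<sigma> 0) (1 + b + (n * (b + 1) + 1)) (\<sigma> (Suc n))"
    using Suc.prems by (intro runs_LoopT[of _ _ _ _ _ _ "\<sigma> (Suc 0)"]) auto
  then show ?case by (simp add: algebra_simps)
qed

lemma top_of_Cons [simp]: "s X = a # w \<Longrightarrow> top_of s X = Some a"
  by (simp add: top_of_def)

text \<open>The last symbol is pushed first, so that the stack reads \<open>w\<close> from the
  top.\<close>

primrec push_word :: "nat \<Rightarrow> word \<Rightarrow> prog" where
  "push_word X [] = Skip"
| "push_word X (a # w) = Seq (push_word X w) (Push X a)"

lemma runs_push_word: "runs g (push_word X w) s (length w + 1) (s(X := w @ s X))"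
proof (induction w)
  case Nil
  then show ?case using runs_Skip[of g s] by simp
next
  case (Cons a w)
  from runs_Seq[OF this runs_Push[of g X a]] show ?case by (simp add: fun_upd_def if_distrib cong: if_cong)
qed

lemma query_free_push_word: "query_free (push_word X w)"
  by (induction w) auto

text \<open>No single command copies an unknown symbol, so the finitely many candidates are tested
  in turn.\<close>

primrec move_among :: "nat \<Rightarrow> nat \<Rightarrow> sym list \<Rightarrow> prog" where
  "move_among X Y [] = Skip"
| "move_among X Y (a # as) = Branch X {Some a} (Seq (Pop X) (Push Y a)) (move_among X Y as)"

lemma runs_move_among:
  assumes "a \<in> set as" "s X = a # w" "X \<noteq> Y"
  shows "runs g (move_among X Y as) s (length as + 2) (s(X := w, Y := a # s Y))"
  using assms
proof (induction as)
  case Nil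
  then show ?case by simp
next
  case (Cons b as)
  show ?case
  proof (cases "a = b")
    case True
    have "runs g (Seq (Pop X) (Push Y a)) s 2 (s(X := w, Y := a # s Y))"
      using runs_Seq[OF runs_Pop[of g X s] runs_Push[of g Y a]] Cons.prems by (simp add: numeral_2_eq_2)
    then have "runs g (move_among X Y (b # as)) s (1 + 2) (s(X := w, Y := a # s Y))"
      using Cons.prems True by (simp only: move_among.simps, intro runs_BranchT) auto
    then show ?thesis by (rule runs_mono) auto
  next
    case False
    then have "runs g (move_among X Y (b # as)) s (1 + (length as + 2)) (s(X := w, Y := a # s Y))"
      using Cons by (simp only: move_among.simps, intro runs_BranchF) (auto simp: fun_upd_def)
    then show ?thesis by (simp add: fun_upd_def)
  qed
qed

definition move_top :: "nat \<Rightarrow> nat \<Rightarrow> prog" where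
  "move_top X Y = move_among X Y [Digit True, Digit False, Sep, Open, Close]"

lemma runs_move_top:
  assumes "s X = a # w" "X \<noteq> Y"
  shows "runs g (move_top X Y) s 7 (s(X := w, Y := a # s Y))"
proof -
  have "a \<in> set [Digit True, Digit False, Sep, Open, Close]"
    by (cases a) auto
  from runs_move_among[where s = s and g = g, OF this assms] show ?thesis
    by (simp add: move_top_def eval_nat_numeral del: move_among.simps)
qed

lemma query_free_move_top: "query_free (move_top X Y)"
  by (simp add: move_top_def)

section \<open>Composing programs\<close>

text \<open>\<open>R X N\<close> applies \<open>f\<close> to stack \<open>X\<close>, using stacks from \<open>N\<close> on as scratch space that is empty
  before and afterwards.\<close>

definition computes_in_place :: "(nat \<Rightarrow> nat \<Rightarrow> prog) \<Rightarrow> (word \<Rightarrow> word) \<Rightarrow> nat poly \<Rightarrow> bool" where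
  "computes_in_place R f r \<longleftrightarrow> (\<forall>X N. query_free (R X N) \<and>
     (\<forall>g s. X < N \<longrightarrow> (\<forall>i\<ge>N. s i = []) \<longrightarrow>
        runs g (R X N) s (poly r (length (s X))) (s(X := f (s X)))))"

text \<open>From this index on, stacks are free to serve as scratch space.\<close>

primrec stacks_below :: "prog \<Rightarrow> nat" where
  "stacks_below Skip = 0"
| "stacks_below (Push X a) = Suc X"
| "stacks_below (Pop X) = Suc X"
| "stacks_below (Query X) = Suc X"
| "stacks_below (Seq c1 c2) = max (stacks_below c1) (stacks_below c2)"
| "stacks_below (Branch X A c1 c2) = Max {Suc X, stacks_below c1, stacks_below c2}"
| "stacks_below (Loop X A c) = max (Suc X) (stacks_below c)"

text \<open>Simulates the oracle \<open>g \<circ> f\<close> by the oracle \<open>g\<close>: each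
  question is rewritten by \<open>f\<close> in place just before it is asked.\<close>

primrec preprocess_queries :: "(nat \<Rightarrow> prog) \<Rightarrow> prog \<Rightarrow> prog" where
  "preprocess_queries R Skip = Skip"
| "preprocess_queries R (Push X a) = Push X a"
| "preprocess_queries R (Pop X) = Pop X"
| "preprocess_queries R (Query X) = Seq (R X) (Query X)"
| "preprocess_queries R (Seq c1 c2) = Seq (preprocess_queries R c1) (preprocess_queries R c2)"
| "preprocess_queries R (Branch X A c1 c2) =
     Branch X A (preprocess_queries R c1) (preprocess_queries R c2)"
| "preprocess_queries R (Loop X A c) = Loop X A (preprocess_queries R c)"

lemma poly_nat_mono: "x \<le> y \<Longrightarrow> poly p x \<le> poly p y" for p :: "nat poly"
  by (induction p) (auto intro!: mult_mono)

lemma exec_unaffected: "exec g c s t s' \<Longrightarrow> stacks_below c \<le> i \<Longrightarrow> s' i = s i"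
  by (induction rule: exec.induct) auto

text \<open>Time bounds are given the form \<open>t * w t\<close> because it is superadditive: the
  bounds for consecutive pieces add up to one for the total time.\<close>

lemma mult_poly_superadditive:
  "a * poly w a + b * poly w b \<le> (a + b) * poly w (a + b)" for w :: "nat poly"
  using poly_nat_mono[of a "a + b" w] poly_nat_mono[of b "a + b" w]
  by (auto simp: distrib_right intro!: add_mono)

text \<open>Only queries become more expensive, and the time of a query already covers the length of
  the word to which \<open>f\<close> is applied. The scratch stacks lie above those of
  \<open>c\<close> and hence stay empty between queries.\<close>

lemma runs_preprocess_queries:
  fixes r :: "nat poly"
  assumes R: "computes_in_place R f r"
    and len: "\<And>x. length (f x) \<le> poly r (length x)"
    and "exec (\<lambda>x. g (f x)) c s t s'" "stacks_below c \<le> N" "\<forall>i\<ge>N. s i = []"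
  shows "runs g (preprocess_queries (\<lambda>X. R X N) c) s (t * poly (2 * r + 2) t) s'"
  using assms(3-)
proof (induction rule: exec.induct)
  case (Query X s)
  define q where "q = s X"
  \<comment> \<open>The time charged for this query in the simulated run, whose oracle is
    \<open>g \<circ> f\<close>.\<close>
  define t where "t = 1 + length q + length (g (f q))"
  have "runs g (R X N) s (poly r (length q)) (s(X := f q))"
    using R Query by (simp add: computes_in_place_def q_def)
  from runs_Seq[OF this runs_Query[of g X]]
  have "runs g (Seq (R X N) (Query X)) s
    (poly r (length q) + (1 + length (f q) + length (g (f q)))) (s(X := g (f q)))"
    by simp
  moreover have "poly r (length q) + (1 + length (f q) + length (g (f q))) \<le> t * poly (2 * r + 2) t"
  proof -
    have "poly r (length q) \<le> poly r t"
      by (rule poly_nat_mono) (simp add: t_def)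
    then have "poly r (length q) + (1 + length (f q) + length (g (f q))) \<le> 2 * poly r t + t"
      using len[of q] by (simp add: t_def)
    also have "\<dots> \<le> t * (2 * poly r t) + t * 2"
      by (intro add_mono) (auto simp: t_def)
    finally show ?thesis by (simp add: algebra_simps)
  qed
  ultimately have "runs g (Seq (R X N) (Query X)) s (t * poly (2 * r + 2) t) (s(X := g (f q)))"
    by (rule runs_mono)
  then show ?case
    by (simp only: preprocess_queries.simps t_def q_def)
next
  case (Seq c1 s t1 s1 c2 t2 s2)
  have "\<forall>i\<ge>N. s1 i = []"
    using exec_unaffected[OF Seq.hyps(1)] Seq.prems by auto
  with Seq have "runs g (preprocess_queries (\<lambda>X. R X N) (Seq c1 c2)) s
      (t1 * poly (2 * r + 2) t1 + t2 * poly (2 * r + 2) t2) s2"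
    by (auto intro: runs_Seq)
  then show ?case using mult_poly_superadditive runs_mono by blast
next
  case (BranchT s X A c1 t s' c2)
  then have "runs g (preprocess_queries (\<lambda>X. R X N) (Branch X A c1 c2)) s
      (1 + t * poly (2 * r + 2) t) s'"
    by (auto intro!: runs_BranchT[simplified])
  moreover have "1 + t * poly (2 * r + 2) t \<le> (1 + t) * poly (2 * r + 2) (1 + t)"
    using mult_poly_superadditive[of 1 "2 * r + 2" t] by simp
  ultimately show ?case by (rule runs_mono)
next
  case (BranchF s X A c2 t s' c1)
  then have "runs g (preprocess_queries (\<lambda>X. R X N) (Branch X A c1 c2)) s
      (1 + t * poly (2 * r + 2) t) s'"
    by (auto intro!: runs_BranchF[simplified])
  moreover have "1 + t * poly (2 * r + 2) t \<le> (1 + t) * poly (2 * r + 2) (1 + t)"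
    using mult_poly_superadditive[of 1 "2 * r + 2" t] by simp
  ultimately show ?case by (rule runs_mono)
next
  case (LoopT s X A c t1 s1 t2 s2)
  have "\<forall>i\<ge>N. s1 i = []"
    using exec_unaffected[OF LoopT.hyps(2)] LoopT.prems by auto
  with LoopT have "runs g (preprocess_queries (\<lambda>X. R X N) (Loop X A c)) s
      (1 + t1 * poly (2 * r + 2) t1 + t2 * poly (2 * r + 2) t2) s2"
    by (auto intro!: runs_LoopT[simplified])
  moreover have "1 + t1 * poly (2 * r + 2) t1 + t2 * poly (2 * r + 2) t2
      \<le> (1 + t1 + t2) * poly (2 * r + 2) (1 + t1 + t2)"
    using mult_poly_superadditive[of 1 "2 * r + 2" t1]
      mult_poly_superadditive[of "1 + t1" "2 * r + 2" t2] by simp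
  ultimately show ?case by (rule runs_mono)
qed (auto intro: runs_mono[OF runs_Skip] runs_mono[OF runs_Push] runs_mono[OF runs_Pop]
      runs_mono[OF runs_LoopF])

section \<open>Transfer of hardness along a conversion of words\<close>

lemma init_single: "init [x] = (\<lambda>_. [])(0 := x)"
  by (auto simp: init_def fun_eq_iff)

text \<open>A Turing reduction to \<open>A\<close> runs with an oracle for \<open>B\<close> once
  every question passes through \<open>f\<close>; by \<open>sol\<close> the answers need no
  translation back.\<close>

lemma NP_hard_transfer:
  assumes "NP_hard A"
    and R: "computes_in_place R f r"
    and len: "\<And>x. length (f x) \<le> poly r (length x)"
    and sol: "\<And>g. solves g (optimal_answer B) \<Longrightarrow> solves (\<lambda>x. g (f x)) (optimal_answer A)"
  shows "NP_hard B"
  unfolding NP_hard_def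
proof
  fix L assume "L \<in> class_NP"
  with assms(1) obtain c and p :: "nat poly" where cp: "\<And>g x. solves g (optimal_answer A) \<Longrightarrow>
      outputs g c [x] (poly p (length x)) (verdict (x \<in> L))"
    unfolding NP_hard_def by blast
  \<comment> \<open>At least 1, because stack 0 holds the input and the scratch stacks must start
    empty.\<close>
  define N where "N = max 1 (stacks_below c)"
  have "outputs g (preprocess_queries (\<lambda>X. R X N) c) [x]
      (poly (p * pcompose (2 * r + 2) p) (length x)) (verdict (x \<in> L))"
    if g: "solves g (optimal_answer B)" for g x
  proof -
    obtain t s where ts: "exec (\<lambda>x. g (f x)) c (init [x]) t s" "t \<le> poly p (length x)"
        "s 0 = verdict (x \<in> L)"
      using cp[OF sol[OF g], of x] by (auto simp: outputs_def)
    have "runs g (preprocess_queries (\<lambda>X. R X N) c) (init [x]) (t * poly (2 * r + 2) t) s"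
      by (rule runs_preprocess_queries[OF R len ts(1)]) (auto simp: N_def init_single)
    moreover have "t * poly (2 * r + 2) t \<le> poly (p * pcompose (2 * r + 2) p) (length x)"
      using ts(2) poly_nat_mono[OF ts(2), of "2 * r + 2"]
      by (simp only: poly_pcompose poly_mult mult_mono)
    ultimately show ?thesis
      using ts(3) runs_mono unfolding outputs_iff_runs by blast
  qed
  then show "\<exists>c (p :: nat poly). \<forall>g. solves g (optimal_answer B) \<longrightarrow>
      (\<forall>x. outputs g c [x] (poly p (length x)) (verdict (x \<in> L)))"
    by blast
qed

text \<open>Here the conversion runs once, before the solver. By \<open>ex\<close> the solver has to
  answer on \<open>f x\<close>, and by \<open>sol\<close> its answer serves for \<open>x\<close> as
  it stands.\<close>

lemma polytime_solvable_transfer: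
  assumes "polytime_solvable Q'"
    and R: "computes_in_place R f r"
    and len: "\<And>x. length (f x) \<le> poly r (length x)"
    and ex: "\<And>x y. Q x y \<Longrightarrow> \<exists>y'. Q' (f x) y'"
    and sol: "\<And>x y y'. Q x y \<Longrightarrow> Q' (f x) y' \<Longrightarrow> Q x y'"
  shows "polytime_solvable Q"
proof -
  obtain c and p :: "nat poly" where c: "query_free c"
    and cp: "\<And>x y. Q' x y \<Longrightarrow> \<exists>y. outputs no_oracle c [x] (poly p (length x)) y \<and> Q' x y"
    using assms(1) unfolding polytime_solvable_def by blast
  have "\<exists>y. outputs no_oracle (Seq (R 0 1) c) [x] (poly (r + pcompose p r) (length x)) y \<and> Q x y"
    if xy: "Q x y" for x y
  proof -
    obtain y' where y': "outputs no_oracle c [f x] (poly p (length (f x))) y'" "Q' (f x) y'"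
      using ex[OF xy] cp by blast
    then obtain s where s: "runs no_oracle c (init [f x]) (poly p (length (f x))) s" "s 0 = y'"
      by (auto simp: outputs_iff_runs)
    have "runs no_oracle (R 0 1) (init [x]) (poly r (length x)) (init [f x])"
      using R[unfolded computes_in_place_def, rule_format, of 0 1, THEN conjunct2, rule_format,
          of "init [x]" no_oracle]
      by (simp add: init_single)
    from runs_Seq[OF this s(1)]
    have "runs no_oracle (Seq (R 0 1) c) (init [x]) (poly r (length x) + poly p (length (f x))) s" .
    moreover have "poly r (length x) + poly p (length (f x)) \<le> poly (r + pcompose p r) (length x)"
      using poly_nat_mono[OF len[of x], of p] by (simp add: poly_pcompose)
    ultimately have "runs no_oracle (Seq (R 0 1) c) (init [x]) (poly (r + pcompose p r) (length x)) s"
      by (rule runs_mono)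
    then show ?thesis
      using s(2) sol[OF xy y'(2)] unfolding outputs_iff_runs by blast
  qed
  moreover have "query_free (Seq (R 0 1) c)"
    using R c by (simp add: computes_in_place_def)
  ultimately show ?thesis
    unfolding polytime_solvable_def by blast
qed

section \<open>Appending a scenario to an encoded instance\<close>

definition job_word :: "nat \<Rightarrow> word" where
  "job_word k = replicate k (Digit False) @
     [Digit True, Sep, Digit True, Sep, Sep, Digit True, Sep]"

definition pad_length :: "bool \<Rightarrow> word \<Rightarrow> nat" where
  "pad_length u x = (if u then 0 else length (dropWhile (\<lambda>a. a = Digit True) x))"

text \<open>The leading digits of an encoded instance count the jobs in unary, and its last symbol closes
  the list of scenarios.\<close>

definition append_scenario_word :: "bool \<Rightarrow> word \<Rightarrow> word \<Rightarrow> word" where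
  "append_scenario_word u w x = w @ butlast x @ Open #
     concat (replicate (length (takeWhile (\<lambda>a. a = Digit True) x)) (job_word (pad_length u x))) @
     [Close, Close]"

text \<open>Stack \<open>X\<close> holds input and output, \<open>N\<close> the reversed input,
  \<open>N + 1\<close> the exponent in unary, \<open>N + 2\<close> the number of jobs still to be
  written in unary, and \<open>N + 3\<close> a temporary copy of the exponent.\<close>

definition regs ::
  "state \<Rightarrow> nat \<Rightarrow> nat \<Rightarrow> word \<Rightarrow> word \<Rightarrow> word \<Rightarrow> word \<Rightarrow> word \<Rightarrow> state" where
  "regs s X N x a b c d = s(X := x, N := a, N + 1 := b, N + 2 := c, N + 3 := d)"

definition count_jobs :: "nat \<Rightarrow> nat \<Rightarrow> prog" where
  "count_jobs X N = Loop X {Some (Digit True)}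
     (Seq (Pop X) (Seq (Push N (Digit True)) (Push (N + 2) (Digit True))))"

definition reverse_rest :: "bool \<Rightarrow> nat \<Rightarrow> nat \<Rightarrow> prog" where
  "reverse_rest u X N = Loop X (range Some)
     (Seq (move_top X N) (if u then Skip else Push (N + 1) (Digit False)))"

text \<open>Reading a stack empties it, so the exponent is saved to \<open>N + 3\<close> while the
  zeros are written and then restored for the next job.\<close>

definition push_job :: "nat \<Rightarrow> nat \<Rightarrow> prog" where
  "push_job X N =
     Seq (push_word X (job_word 0))
    (Seq (Loop (N + 1) (range Some)
           (Seq (Pop (N + 1)) (Seq (Push (N + 3) (Digit False)) (Push X (Digit False)))))
         (Loop (N + 3) (range Some)
           (Seq (Pop (N + 3)) (Push (N + 1) (Digit False)))))"

definition push_scenario :: "nat \<Rightarrow> nat \<Rightarrow> prog" where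
  "push_scenario X N = Loop (N + 2) (range Some) (Seq (Pop (N + 2)) (push_job X N))"

text \<open>The output is built from its end: closing brackets, jobs, opening bracket, the input
  without its last symbol, and \<open>w\<close> on top. The exponent is erased last.\<close>

definition append_scenario_prog :: "bool \<Rightarrow> word \<Rightarrow> nat \<Rightarrow> nat \<Rightarrow> prog" where
  "append_scenario_prog u w X N =
     Seq (count_jobs X N)
    (Seq (reverse_rest u X N)
    (Seq (push_word X [Close, Close])
    (Seq (push_scenario X N)
    (Seq (Push X Open)
    (Seq (Pop N)
    (Seq (Loop N (range Some) (move_top N X))
    (Seq (push_word X w)
         (Loop (N + 1) (range Some) (Pop (N + 1))))))))))"

lemma query_free_append_scenario_prog: "query_free (append_scenario_prog u w X N)"
  by (simp add: append_scenario_prog_def count_jobs_def reverse_rest_def push_scenario_def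
      push_job_def query_free_push_word query_free_move_top)

section \<open>Correctness and running time of the appending program\<close>

context
  fixes g :: "word \<Rightarrow> word" and s :: state and X N :: nat
  assumes XN: "X < N"
begin

abbreviation (input) "\<sigma> \<equiv> regs s X N"

lemma regs_apply [simp]:
  "\<sigma> x a b c d X = x" "\<sigma> x a b c d N = a" "\<sigma> x a b c d (N + 1) = b"
  "\<sigma> x a b c d (N + 2) = c" "\<sigma> x a b c d (N + 3) = d"
  using XN by (auto simp: regs_def)

lemma regs_update [simp]:
  "(\<sigma> x a b c d)(X := v) = \<sigma> v a b c d" "(\<sigma> x a b c d)(N := v) = \<sigma> x v b c d"
  "(\<sigma> x a b c d)(N + 1 := v) = \<sigma> x a v c d" "(\<sigma> x a b c d)(N + 2 := v) = \<sigma> x a b v d"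
  "(\<sigma> x a b c d)(N + 3 := v) = \<sigma> x a b c v"
  using XN by (auto simp: regs_def fun_eq_iff)

lemmas runs_regs_Pop =
  runs_Pop[of g X "\<sigma> x a b c d" for x a b c d, unfolded regs_apply regs_update]
  runs_Pop[of g N "\<sigma> x a b c d" for x a b c d, unfolded regs_apply regs_update]
  runs_Pop[of g "N + 1" "\<sigma> x a b c d" for x a b c d, unfolded regs_apply regs_update]
  runs_Pop[of g "N + 2" "\<sigma> x a b c d" for x a b c d, unfolded regs_apply regs_update]
  runs_Pop[of g "N + 3" "\<sigma> x a b c d" for x a b c d, unfolded regs_apply regs_update]

lemmas runs_regs_Push =
  runs_Push[of g X _ "\<sigma> x a b c d" for x a b c d, unfolded regs_apply regs_update]
  runs_Push[of g N _ "\<sigma> x a b c d" for x a b c d, unfolded regs_apply regs_update]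
  runs_Push[of g "N + 1" _ "\<sigma> x a b c d" for x a b c d, unfolded regs_apply regs_update]
  runs_Push[of g "N + 2" _ "\<sigma> x a b c d" for x a b c d, unfolded regs_apply regs_update]
  runs_Push[of g "N + 3" _ "\<sigma> x a b c d" for x a b c d, unfolded regs_apply regs_update]

text \<open>The condition on \<open>y\<close> stops the loop right after the unary number.\<close>

lemma runs_count_jobs:
  assumes "y = [] \<or> hd y \<noteq> Digit True"
  shows "runs g (count_jobs X N) (\<sigma> (replicate n (Digit True) @ y) a b c d) (4 * n + 1)
    (\<sigma> y (replicate n (Digit True) @ a) b (replicate n (Digit True) @ c) d)"
proof -
  let ?T = "\<lambda>i. replicate i (Digit True)"
  let ?\<sigma> = "\<lambda>i. \<sigma> (?T (n - i) @ y) (?T i @ a) b (?T i @ c) d"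
  have "runs g (count_jobs X N) (?\<sigma> 0) (n * (3 + 1) + 1) (?\<sigma> n)"
    unfolding count_jobs_def
  proof (rule runs_iterate)
    show "top_of (?\<sigma> i) X \<in> {Some (Digit True)}" if "i < n" for i
      using that by (cases "n - i") (auto simp: top_of_def)
    show "top_of (?\<sigma> n) X \<notin> {Some (Digit True)}"
      using assms by (cases y) (auto simp: top_of_def)
    fix i assume "i < n"
    then obtain m where "n - i = Suc m" "n - Suc i = m" by (metis Suc_diff_Suc)
    moreover have "runs g (Seq (Pop X) (Seq (Push N (Digit True)) (Push (N + 2) (Digit True))))
        (?\<sigma> i) (1 + (1 + 1))
        (\<sigma> (tl (?T (n - i) @ y)) (Digit True # ?T i @ a) b (Digit True # ?T i @ c) d)"
      by (intro runs_Seq) (rule runs_regs_Pop runs_regs_Push)+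
    ultimately show "runs g (Seq (Pop X) (Seq (Push N (Digit True)) (Push (N + 2) (Digit True))))
        (?\<sigma> i) 3 (?\<sigma> (Suc i))"
      by (simp add: eval_nat_numeral)
  qed
  then show ?thesis by (simp add: algebra_simps)
qed

lemma runs_reverse_rest:
  "runs g (reverse_rest u X N) (\<sigma> y a [] c d) (9 * length y + 1)
    (\<sigma> [] (rev y @ a) (replicate (if u then 0 else length y) (Digit False)) c d)"
proof -
  let ?F = "\<lambda>i. replicate (if u then 0 else i) (Digit False)"
  let ?\<sigma> = "\<lambda>i. \<sigma> (drop i y) (rev (take i y) @ a) (?F i) c d"
  have "runs g (reverse_rest u X N) (?\<sigma> 0) (length y * (8 + 1) + 1) (?\<sigma> (length y))"
    unfolding reverse_rest_def
  proof (rule runs_iterate)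
    show "top_of (?\<sigma> i) X \<in> range Some" if "i < length y" for i
      using that by (auto simp: top_of_def split: list.splits)
    show "top_of (?\<sigma> (length y)) X \<notin> range Some"
      by (auto simp: top_of_def)
    fix i assume i: "i < length y"
    have 1: "runs g (move_top X N) (?\<sigma> i) 7 (\<sigma> (drop (Suc i) y) (rev (take (Suc i) y) @ a) (?F i) c d)"
      using runs_move_top[of "?\<sigma> i" X "y ! i" "drop (Suc i) y" N g] i XN
      by (simp add: Cons_nth_drop_Suc take_Suc_conv_app_nth)
    have 2: "runs g (if u then Skip else Push (N + 1) (Digit False))
        (\<sigma> (drop (Suc i) y) (rev (take (Suc i) y) @ a) (?F i) c d) 1 (?\<sigma> (Suc i))"
      using runs_Skip runs_regs_Push(3) by auto
    from runs_Seq[OF 1 2]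
    show "runs g (Seq (move_top X N) (if u then Skip else Push (N + 1) (Digit False)))
        (?\<sigma> i) 8 (?\<sigma> (Suc i))"
      by simp
  qed
  then show ?thesis by (simp add: algebra_simps)
qed

lemma runs_push_job:
  "runs g (push_job X N) (\<sigma> x a (replicate k (Digit False)) c []) (7 * k + 10)
    (\<sigma> (job_word k @ x) a (replicate k (Digit False)) c [])"
proof -
  let ?F = "\<lambda>i. replicate i (Digit False)"
  let ?x = "job_word 0 @ x"
  \<comment> \<open>\<open>?\<sigma>\<close> traces the loop that writes the zeros and
    \<open>?\<tau>\<close> the one that restores the exponent; they meet at
    \<open>?\<sigma> k = ?\<tau> 0\<close>.\<close>
  let ?\<sigma> = "\<lambda>i. \<sigma> (?F i @ ?x) a (?F (k - i)) c (?F i)"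
  let ?\<tau> = "\<lambda>i. \<sigma> (?F k @ ?x) a (?F i) c (?F (k - i))"
  have 1: "runs g (push_word X (job_word 0)) (\<sigma> x a (?F k) c []) 8 (?\<sigma> 0)"
    using runs_push_word[of g X "job_word 0" "\<sigma> x a (?F k) c []"]
    by (simp add: job_word_def eval_nat_numeral)
  have 2: "runs g (Loop (N + 1) (range Some)
      (Seq (Pop (N + 1)) (Seq (Push (N + 3) (Digit False)) (Push X (Digit False)))))
      (?\<sigma> 0) (k * (3 + 1) + 1) (?\<sigma> k)"
  proof (rule runs_iterate)
    show "top_of (?\<sigma> i) (N + 1) \<in> range Some" if "i < k" for i
      using that by (cases "k - i") (auto simp: top_of_def simp del: add_2_eq_Suc' One_nat_def)
    show "top_of (?\<sigma> k) (N + 1) \<notin> range Some"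
      by (auto simp: top_of_def simp del: One_nat_def)
    fix i assume "i < k"
    then obtain m where "k - i = Suc m" "k - Suc i = m" by (metis Suc_diff_Suc)
    moreover have "runs g
        (Seq (Pop (N + 1)) (Seq (Push (N + 3) (Digit False)) (Push X (Digit False))))
        (?\<sigma> i) (1 + (1 + 1))
        (\<sigma> (Digit False # ?F i @ ?x) a (tl (?F (k - i))) c (Digit False # ?F i))"
      by (intro runs_Seq) (rule runs_regs_Pop runs_regs_Push)+
    ultimately show "runs g
        (Seq (Pop (N + 1)) (Seq (Push (N + 3) (Digit False)) (Push X (Digit False))))
        (?\<sigma> i) 3 (?\<sigma> (Suc i))"
      by (simp add: eval_nat_numeral)
  qed
  have 3: "runs g (Loop (N + 3) (range Some) (Seq (Pop (N + 3)) (Push (N + 1) (Digit False))))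
      (?\<tau> 0) (k * (2 + 1) + 1) (?\<tau> k)"
  proof (rule runs_iterate)
    show "top_of (?\<tau> i) (N + 3) \<in> range Some" if "i < k" for i
      using that by (cases "k - i") (auto simp: top_of_def)
    show "top_of (?\<tau> k) (N + 3) \<notin> range Some"
      by (auto simp: top_of_def)
    fix i assume "i < k"
    then obtain m where "k - i = Suc m" "k - Suc i = m" by (metis Suc_diff_Suc)
    moreover have "runs g (Seq (Pop (N + 3)) (Push (N + 1) (Digit False))) (?\<tau> i) (1 + 1)
        (\<sigma> (?F k @ ?x) a (Digit False # ?F i) c (tl (?F (k - i))))"
      by (intro runs_Seq) (rule runs_regs_Pop runs_regs_Push)+
    ultimately show "runs g (Seq (Pop (N + 3)) (Push (N + 1) (Digit False))) (?\<tau> i) 2 (?\<tau> (Suc i))"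
      by (simp add: eval_nat_numeral)
  qed
  have "?\<sigma> k = ?\<tau> 0" "?\<tau> k = \<sigma> (job_word k @ x) a (?F k) c []"
    by (simp_all add: job_word_def)
  with runs_Seq[OF 1 runs_Seq[OF 2]] 3
  have "runs g (push_job X N) (\<sigma> x a (?F k) c []) (8 + (k * (3 + 1) + 1 + (k * (2 + 1) + 1)))
      (\<sigma> (job_word k @ x) a (?F k) c [])"
    unfolding push_job_def by metis
  then show ?thesis by (rule runs_mono) simp
qed

lemma runs_push_scenario:
  "runs g (push_scenario X N)
    (\<sigma> x a (replicate k (Digit False)) (replicate n (Digit True)) []) (n * (7 * k + 12) + 1)
    (\<sigma> (concat (replicate n (job_word k)) @ x) a (replicate k (Digit False)) [] [])"
proof -
  let ?\<sigma> = "\<lambda>i. \<sigma> (concat (replicate i (job_word k)) @ x) a (replicate k (Digit False))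
    (replicate (n - i) (Digit True)) []"
  have "runs g (push_scenario X N) (?\<sigma> 0) (n * (7 * k + 11 + 1) + 1) (?\<sigma> n)"
    unfolding push_scenario_def
  proof (rule runs_iterate)
    show "top_of (?\<sigma> i) (N + 2) \<in> range Some" if "i < n" for i
      using that by (cases "n - i") (auto simp: top_of_def simp del: add_2_eq_Suc')
    show "top_of (?\<sigma> n) (N + 2) \<notin> range Some"
      by (auto simp: top_of_def simp del: add_2_eq_Suc')
    fix i assume "i < n"
    then obtain m where "n - i = Suc m" "n - Suc i = m" by (metis Suc_diff_Suc)
    then show "runs g (Seq (Pop (N + 2)) (push_job X N)) (?\<sigma> i) (7 * k + 11) (?\<sigma> (Suc i))"
      using runs_Seq[OF runs_regs_Pop(4) runs_push_job,
        of "concat (replicate i (job_word k)) @ x" a k "replicate (n - i) (Digit True)"]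
      by (simp add: eval_nat_numeral)
  qed
  then show ?thesis by (simp add: algebra_simps)
qed

lemma runs_unreverse:
  "runs g (Loop N (range Some) (move_top N X)) (\<sigma> x a b c d) (8 * length a + 1)
    (\<sigma> (rev a @ x) [] b c d)"
proof -
  let ?\<sigma> = "\<lambda>i. \<sigma> (rev (take i a) @ x) (drop i a) b c d"
  have "runs g (Loop N (range Some) (move_top N X)) (?\<sigma> 0) (length a * (7 + 1) + 1) (?\<sigma> (length a))"
  proof (rule runs_iterate)
    show "top_of (?\<sigma> i) N \<in> range Some" if "i < length a" for i
      using that by (auto simp: top_of_def split: list.splits)
    show "top_of (?\<sigma> (length a)) N \<notin> range Some"
      by (auto simp: top_of_def)
    show "runs g (move_top N X) (?\<sigma> i) 7 (?\<sigma> (Suc i))" if "i < length a" for i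
      using runs_move_top[of "?\<sigma> i" N "a ! i" "drop (Suc i) a" X g] that XN
      by (simp add: Cons_nth_drop_Suc take_Suc_conv_app_nth)
  qed
  then show ?thesis by (simp add: algebra_simps)
qed

lemma runs_clear:
  "runs g (Loop (N + 1) (range Some) (Pop (N + 1))) (\<sigma> x a b c d) (2 * length b + 1) (\<sigma> x a [] c d)"
proof -
  let ?\<sigma> = "\<lambda>i. \<sigma> x a (drop i b) c d"
  have "runs g (Loop (N + 1) (range Some) (Pop (N + 1))) (?\<sigma> 0) (length b * (1 + 1) + 1) (?\<sigma> (length b))"
  proof (rule runs_iterate)
    show "top_of (?\<sigma> i) (N + 1) \<in> range Some" if "i < length b" for i
      using that by (auto simp: top_of_def simp del: One_nat_def split: list.splits)
    show "top_of (?\<sigma> (length b)) (N + 1) \<notin> range Some"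
      by (auto simp: top_of_def simp del: One_nat_def)
    show "runs g (Pop (N + 1)) (?\<sigma> i) 1 (?\<sigma> (Suc i))" for i
      using runs_regs_Pop(3)[of x a "drop i b" c d] by (simp only: drop_Suc tl_drop)
  qed
  then show ?thesis by (simp add: mult_2)
qed

lemma runs_append_scenario_prog:
  assumes "\<forall>i\<ge>N. s i = []" "s X = x"
  shows "runs g (append_scenario_prog u w X N) s
    (7 * (length x * length x) + 35 * length x + length w + 20) (s(X := append_scenario_word u w x))"
proof -
  define n where "n = length (takeWhile (\<lambda>a. a = Digit True) x)"
  define y where "y = dropWhile (\<lambda>a. a = Digit True) x"
  define k where "k = pad_length u x"
  let ?T = "replicate n (Digit True)"
  let ?F = "replicate k (Digit False)"
  let ?z = "concat (replicate n (job_word k)) @ [Close, Close]"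
  have "?T = takeWhile (\<lambda>a. a = Digit True) x"
    unfolding n_def by (rule replicate_eqI[symmetric]) (auto dest: set_takeWhileD)
  then have x: "x = ?T @ y"
    by (simp add: y_def)
  have y: "y = [] \<or> hd y \<noteq> Digit True"
    using hd_dropWhile[of "\<lambda>a. a = Digit True" x] by (auto simp: y_def)
  have k: "k = (if u then 0 else length y)"
    by (simp add: k_def y_def pad_length_def)
  \<comment> \<open>A block of equal symbols is its own reverse, so stack \<open>N\<close> ends up
    with the whole input reversed.\<close>
  have rx: "rev y @ ?T = rev x"
    by (subst x) simp
  have s: "s = \<sigma> x [] [] [] []" "\<sigma> v [] [] [] [] = s(X := v)" for v
    using assms XN by (auto simp: regs_def fun_eq_iff)
  have 1: "runs g (count_jobs X N) (\<sigma> x [] [] [] []) (4 * n + 1) (\<sigma> y ?T [] ?T [])"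
    using runs_count_jobs[OF y, of n "[]" "[]" "[]" "[]"] x by simp
  have 2: "runs g (reverse_rest u X N) (\<sigma> y ?T [] ?T []) (9 * length y + 1) (\<sigma> [] (rev x) ?F ?T [])"
    using runs_reverse_rest[of u y ?T ?T "[]"] by (simp add: rx k)
  have 3: "runs g (push_word X [Close, Close]) (\<sigma> [] (rev x) ?F ?T []) 3
      (\<sigma> [Close, Close] (rev x) ?F ?T [])"
    using runs_push_word[of g X "[Close, Close]" "\<sigma> [] (rev x) ?F ?T []"]
    by (simp add: eval_nat_numeral)
  have 4: "runs g (push_scenario X N) (\<sigma> [Close, Close] (rev x) ?F ?T []) (n * (7 * k + 12) + 1)
      (\<sigma> ?z (rev x) ?F [] [])"
    by (rule runs_push_scenario)
  have 5: "runs g (Push X Open) (\<sigma> ?z (rev x) ?F [] []) 1 (\<sigma> (Open # ?z) (rev x) ?F [] [])"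
    by (rule runs_regs_Push(1))
  \<comment> \<open>On the reversed input this removes the last symbol, which in an encoded instance
    closes the list of scenarios.\<close>
  have 6: "runs g (Pop N) (\<sigma> (Open # ?z) (rev x) ?F [] []) 1 (\<sigma> (Open # ?z) (tl (rev x)) ?F [] [])"
    by (rule runs_regs_Pop(2))
  have tl: "rev (tl (rev x)) = butlast x"
    by (metis butlast_rev rev_swap)
  have 7: "runs g (Loop N (range Some) (move_top N X)) (\<sigma> (Open # ?z) (tl (rev x)) ?F [] [])
      (8 * length x + 1) (\<sigma> (butlast x @ Open # ?z) [] ?F [] [])"
    by (rule runs_mono[OF runs_unreverse[of "Open # ?z" "tl (rev x)", unfolded tl]]) simp
  have 8: "runs g (push_word X w) (\<sigma> (butlast x @ Open # ?z) [] ?F [] []) (length w + 1)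
      (\<sigma> (w @ butlast x @ Open # ?z) [] ?F [] [])"
    using runs_push_word[of g X w "\<sigma> (butlast x @ Open # ?z) [] ?F [] []"] by simp
  have 9: "runs g (Loop (N + 1) (range Some) (Pop (N + 1)))
      (\<sigma> (w @ butlast x @ Open # ?z) [] ?F [] []) (2 * k + 1)
      (\<sigma> (w @ butlast x @ Open # ?z) [] [] [] [])"
    using runs_clear[of "w @ butlast x @ Open # ?z" "[]" ?F "[]" "[]"] by (simp only: length_replicate)
  have "runs g (append_scenario_prog u w X N) (\<sigma> x [] [] [] [])
      (4 * n + 1 + (9 * length y + 1 + (3 + (n * (7 * k + 12) + 1 +
        (1 + (1 + (8 * length x + 1 + (length w + 1 + (2 * k + 1)))))))))
      (\<sigma> (w @ butlast x @ Open # ?z) [] [] [] [])"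
    unfolding append_scenario_prog_def by (intro runs_Seq) (rule 1 2 3 4 5 6 7 8 9)+
  moreover have "w @ butlast x @ Open # ?z = append_scenario_word u w x"
    by (simp add: append_scenario_word_def n_def k_def)
  ultimately have "runs g (append_scenario_prog u w X N) s
      (4 * n + 1 + (9 * length y + 1 + (3 + (n * (7 * k + 12) + 1 +
        (1 + (1 + (8 * length x + 1 + (length w + 1 + (2 * k + 1)))))))))
      (s(X := append_scenario_word u w x))"
    using s by metis
  then show ?thesis
  proof (rule runs_mono)
    have len: "n \<le> length x" "length y \<le> length x" "k \<le> length x"
      by (subst x, simp add: k)+
    \<comment> \<open>The only quadratic term: \<open>n\<close> jobs with \<open>k\<close> zeros
      each.\<close>
    have "n * k \<le> length x * length x"
      using len by (intro mult_mono) auto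
    moreover have "n * (7 * k + 12) = 7 * (n * k) + 12 * n"
      by (simp add: algebra_simps)
    ultimately show "4 * n + 1 + (9 * length y + 1 + (3 + (n * (7 * k + 12) + 1 +
        (1 + (1 + (8 * length x + 1 + (length w + 1 + (2 * k + 1)))))))) \<le>
        7 * (length x * length x) + 35 * length x + length w + 20"
      using len by linarith
  qed
qed

end

text \<open>The transfer lemmas use one polynomial for both the time and the output length. The
  coefficient 35 is the sum of the linear costs 4 + 9 + 12 + 8 + 2 of the loops.\<close>

definition append_scenario_bound :: "word \<Rightarrow> nat poly" where
  "append_scenario_bound w = [:length w + 20, 35, 7:]"

lemma computes_in_place_append_scenario:
  "computes_in_place (append_scenario_prog u w) (append_scenario_word u w) (append_scenario_bound w)"
  unfolding computes_in_place_def
proof (intro allI conjI impI)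
  fix X N :: nat and g s assume "X < N" and "\<forall>i\<ge>N. s i = ([] :: word)"
  then show "runs g (append_scenario_prog u w X N) s (poly (append_scenario_bound w) (length (s X)))
      (s(X := append_scenario_word u w (s X)))"
    using runs_append_scenario_prog[of X N s "s X" g u w]
    by (simp add: append_scenario_bound_def algebra_simps)
qed (rule query_free_append_scenario_prog)

lemma length_append_scenario_word:
  "length (append_scenario_word u w x) \<le> poly (append_scenario_bound w) (length x)"
proof -
  define n k where "n = length (takeWhile (\<lambda>a. a = Digit True) x)" and "k = pad_length u x"
  have le: "n \<le> length x" "k \<le> length x"
    by (auto simp: n_def k_def pad_length_def length_takeWhile_le length_dropWhile_le)
  have "length (append_scenario_word u w x) = length w + (length x - 1) + n * (k + 7) + 3"
    by (simp add: append_scenario_word_def job_word_def length_concat sum_list_replicate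
        algebra_simps flip: n_def k_def)
  moreover have "n * k \<le> length x * length x"
    using le by (intro mult_mono) auto
  moreover have "n * (k + 7) = n * k + 7 * n"
    by (simp add: algebra_simps)
  ultimately have "length (append_scenario_word u w x)
      \<le> 7 * (length x * length x) + 35 * length x + length w + 20"
    using le by linarith
  then show ?thesis
    by (simp add: append_scenario_bound_def algebra_simps)
qed

section \<open>Unique decoding\<close>

text \<open>Arbitrary continuations are allowed so that unique decoding survives concatenation. It
  is relative to a set because \<open>enc_rat\<close> drops the sign.\<close>

definition prefix_code_on :: "'a set \<Rightarrow> ('a \<Rightarrow> word) \<Rightarrow> bool" where
  "prefix_code_on A e \<longleftrightarrow> (\<forall>x\<in>A. \<forall>y\<in>A. \<forall>u v. e x @ u = e y @ v \<longrightarrow> x = y \<and> u = v)"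

lemma prefix_code_onD:
  "prefix_code_on A e \<Longrightarrow> e x @ u = e y @ v \<Longrightarrow> x \<in> A \<Longrightarrow> y \<in> A \<Longrightarrow> x = y \<and> u = v"
  unfolding prefix_code_on_def by blast

lemma prefix_code_on_pair:
  assumes "prefix_code_on A e" "prefix_code_on B f"
  shows "prefix_code_on (A \<times> B) (\<lambda>(x, y). e x @ f y)"
  unfolding prefix_code_on_def
proof (intro ballI allI impI, clarsimp)
  fix x y x' y' u v
  assume "x \<in> A" "y \<in> B" "x' \<in> A" "y' \<in> B" "e x @ f y @ u = e x' @ f y' @ v"
  then show "x = x' \<and> y = y' \<and> u = v"
    using prefix_code_onD[OF assms(1), of x _ x'] prefix_code_onD[OF assms(2), of y u y' v] by blast
qed

lemma bits_inject: "bits m = bits n \<Longrightarrow> m = n"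
proof (induction m arbitrary: n rule: bits.induct)
  case (1 m)
  show ?case
  proof (cases "m = 0")
    case True
    then have "bits n = []" using "1.prems" by (simp add: bits.simps[of 0])
    then show ?thesis using True by (simp add: bits.simps[of n] split: if_splits)
  next
    case False
    then have "bits m = odd m # bits (m div 2)" by (subst bits.simps) simp
    then have "n \<noteq> 0" "odd m = odd n" "bits (m div 2) = bits (n div 2)"
      using "1.prems" by (auto simp: bits.simps[of n] split: if_splits)
    then show ?thesis
      using "1.IH"[OF False] by (metis (no_types) odd_two_times_div_two_succ even_two_times_div_two)
  qed
qed

lemma less_two_power_length_bits: "n < 2 ^ length (bits n)"
proof (induction n rule: bits.induct)
  case (1 n)
  show ?case
  proof (cases "n = 0")
    case False
    then have "n div 2 < 2 ^ length (bits (n div 2))" using 1 by simp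
    then have "n < 2 * 2 ^ length (bits (n div 2))" by linarith
    then show ?thesis using False by (subst bits.simps) simp
  qed simp
qed

lemma bits_two_power: "bits (2 ^ k) = replicate k False @ [True]"
proof (induction k)
  case 0
  show ?case by (simp add: bits.simps[of "Suc 0"] bits.simps[of 0])
next
  case (Suc k)
  then show ?case by (subst bits.simps) simp
qed

lemma map_Digit_Sep_eq:
  "map Digit bs @ Sep # u = map Digit cs @ Sep # v \<Longrightarrow> bs = cs \<and> u = v"
proof (induction bs arbitrary: cs)
  case Nil
  then show ?case by (cases cs) auto
next
  case (Cons b bs)
  then show ?case by (cases cs) auto
qed

lemma prefix_code_on_enc_nat: "prefix_code_on UNIV enc_nat"
  unfolding prefix_code_on_def enc_nat_def
  by (auto dest: map_Digit_Sep_eq bits_inject)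

lemma quotient_of_nonneg:
  assumes "0 \<le> r"
  shows "0 \<le> fst (quotient_of r)"
proof -
  have "r = of_int (fst (quotient_of r)) / of_int (snd (quotient_of r))"
    by (rule quotient_of_div) simp
  with assms quotient_of_denom_pos'[of r] show ?thesis
    by (metis less_le_not_le linorder_not_less divide_neg_pos of_int_0_less_iff of_int_less_0_iff)
qed

lemma prefix_code_on_enc_rat: "prefix_code_on {0..} enc_rat"
  unfolding prefix_code_on_def
proof (intro ballI allI impI)
  fix x y :: rat and u v
  assume xy: "x \<in> {0..}" "y \<in> {0..}" "enc_rat x @ u = enc_rat y @ v"
  then have "nat (fst (quotient_of x)) = nat (fst (quotient_of y))"
    "nat (snd (quotient_of x)) = nat (snd (quotient_of y))" "u = v"
    unfolding enc_rat_def
    by (auto dest!: prefix_code_onD[OF prefix_code_on_enc_nat])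
  \<comment> \<open>On nonnegative integers \<open>nat\<close> is injective, so numerators and
    denominators agree.\<close>
  moreover have "fst (quotient_of x) \<ge> 0" "fst (quotient_of y) \<ge> 0"
    using xy by (auto intro: quotient_of_nonneg)
  moreover have "snd (quotient_of x) > 0" "snd (quotient_of y) > 0"
    by (rule quotient_of_denom_pos')+
  ultimately have "quotient_of x = quotient_of y"
    by (auto simp: prod_eq_iff)
  then show "x = y \<and> u = v"
    using \<open>u = v\<close> by (simp add: quotient_of_inject_eq)
qed

text \<open>As no element starts with \<open>Close\<close>, the end of the list is recognisable, and
  by the prefix property the elements can be split off one by one.\<close>

lemma prefix_code_on_enc_list:
  assumes "prefix_code_on A e" and ne: "\<And>x. x \<in> A \<Longrightarrow> e x \<noteq> [] \<and> hd (e x) \<noteq> Close"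
  shows "prefix_code_on (lists A) (enc_list e)"
proof -
  have "xs = ys \<and> u = v"
    if "concat (map e xs) @ Close # u = concat (map e ys) @ Close # v" "xs \<in> lists A" "ys \<in> lists A"
    for xs ys u v
    using that
  proof (induction xs arbitrary: ys)
    case Nil
    show ?case
    proof (cases ys)
      case (Cons y ys')
      then show ?thesis using Nil ne[of y] by (cases "e y") auto
    qed (use Nil in auto)
  next
    case (Cons x xs)
    show ?case
    proof (cases ys)
      case Nil
      then show ?thesis using Cons.prems ne[of x] by (cases "e x") auto
    next
      case (Cons y ys')
      then have "x = y" "concat (map e xs) @ Close # u = concat (map e ys') @ Close # v"
        using prefix_code_onD[OF assms(1), of x "concat (map e xs) @ Close # u" y
            "concat (map e ys') @ Close # v"] Cons.prems by auto
      then show ?thesis using Cons.IH[of ys'] Cons.prems Cons by auto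
    qed
  qed
  then show ?thesis
    unfolding prefix_code_on_def enc_list_def by auto
qed

lemma replicate_Sep_eq:
  "replicate m (Digit True) @ Sep # u = replicate n (Digit True) @ Sep # v \<Longrightarrow> m = n \<and> u = v"
proof (induction m arbitrary: n)
  case 0
  then show ?case by (cases n) auto
next
  case (Suc m)
  then show ?case by (cases n) auto
qed

lemma enc_nat_hd: "enc_nat n @ w \<noteq> [] \<and> hd (enc_nat n @ w) \<noteq> Close"
  by (cases "bits n") (auto simp: enc_nat_def)

lemma enc_rat_hd: "enc_rat r @ w \<noteq> [] \<and> hd (enc_rat r @ w) \<noteq> Close"
  using enc_nat_hd by (simp add: enc_rat_def)

text \<open>An answer to a word is an answer to some instance with that encoding; injectivity makes
  it the instance built by the reduction.\<close>

lemma inj_on_enc_stochastic: "inj_on enc_stochastic (stochastic_instances P K)"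
proof (rule inj_onI, clarify)
  let ?ep = "\<lambda>(i, j). enc_nat i @ enc_nat j" and ?ej = "\<lambda>(p, d). enc_rat p @ enc_rat d"
  let ?A = "lists ({0..} \<times> {0..}) :: scenario set"
  fix I q I' q'
  assume I: "(I, q) \<in> stochastic_instances P K" "(I', q') \<in> stochastic_instances P K"
    and eq: "enc_stochastic (I, q) = enc_stochastic (I', q')"
  have ej: "prefix_code_on ?A (enc_list ?ej)"
    using enc_rat_hd
    by (intro prefix_code_on_enc_list prefix_code_on_pair prefix_code_on_enc_rat) auto
  have es: "prefix_code_on (lists ?A) (enc_list (enc_list ?ej))"
    by (intro prefix_code_on_enc_list[OF ej]) (auto simp: enc_list_def)
  have ep: "prefix_code_on (lists (UNIV \<times> UNIV)) (enc_list ?ep)"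
    using enc_nat_hd
    by (intro prefix_code_on_enc_list prefix_code_on_pair prefix_code_on_enc_nat) auto
  have eq: "prefix_code_on (lists {0..}) (enc_list enc_rat)"
    using enc_rat_hd[of _ "[]"] by (intro prefix_code_on_enc_list prefix_code_on_enc_rat) auto
  have "q \<in> lists {0..}" "q' \<in> lists {0..}"
    using I by (auto simp: stochastic_instances_def less_imp_le)
  then have q: "q = q'" "enc_uncertain I = enc_uncertain I'"
    using prefix_code_onD[OF eq] \<open>enc_stochastic (I, q) = _\<close> by (auto simp: enc_stochastic_def)
  then have n: "njobs I = njobs I'" and rest:
    "enc_list ?ep (precs I) @ enc_list (enc_list ?ej) (scenarios I) =
     enc_list ?ep (precs I') @ enc_list (enc_list ?ej) (scenarios I')"
    by (auto simp: enc_uncertain_def dest: replicate_Sep_eq)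
  then have p: "precs I = precs I'"
    "enc_list (enc_list ?ej) (scenarios I) @ [] = enc_list (enc_list ?ej) (scenarios I') @ []"
    using prefix_code_onD[OF ep rest] by auto
  have "scenarios I \<in> lists ?A" "scenarios I' \<in> lists ?A"
    using I by (fastforce simp: stochastic_instances_def uncertain_instances_def valid_scenario_def)+
  then have "scenarios I = scenarios I'"
    using prefix_code_onD[OF es p(2)] by auto
  then show "I = I' \<and> q = q'"
    using q n p by (simp add: uncertain_instance.equality)
qed

section \<open>The costs of the additional scenario\<close>

lemma completion_mono:
  assumes "\<And>i. i \<in> set \<pi> \<Longrightarrow> p i \<le> p' i" "j \<in> set \<pi>"
  shows "completion p \<pi> j \<le> completion p' \<pi> j"
  unfolding completion_def using assms
  by (intro add_mono sum_list_mono) (auto dest: set_takeWhileD)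

text \<open>All criteria grow with the completion times and shrink with the due dates. A nonempty
  schedule keeps \<open>Max\<close> meaningful.\<close>

lemma cost_mono:
  assumes p: "\<And>i. i \<in> set \<pi> \<Longrightarrow> p i \<le> p' i" and d: "\<And>i. i \<in> set \<pi> \<Longrightarrow> d' i \<le> d i" and "\<pi> \<noteq> []"
  shows "cost \<gamma> (\<lambda>_. 1) p d \<pi> \<le> cost \<gamma> (\<lambda>_. 1) p' d' \<pi>"
proof -
  have C: "completion p \<pi> j \<le> completion p' \<pi> j" if "j \<in> set \<pi>" for j
    using completion_mono p that by blast
  have T: "tardiness p d \<pi> j \<le> tardiness p' d' \<pi> j" if "j \<in> set \<pi>" for j
    using C[OF that] d[OF that] by (auto simp: tardiness_def max_def)
  show ?thesis
  proof (cases \<gamma>)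
    case MaxTardiness
    have "tardiness p d \<pi> j \<le> Max (tardiness p' d' \<pi> ` set \<pi>)" if "j \<in> set \<pi>" for j
      using T[OF that] that by (meson List.finite_set Max_ge finite_imageI imageI order_trans)
    then show ?thesis using MaxTardiness \<open>\<pi> \<noteq> []\<close> by (auto intro!: Max.boundedI)
  next
    case LateJobs
    then show ?thesis using C d by (fastforce simp: late_def intro!: sum_mono)
  qed (use C T in \<open>auto intro!: sum_mono\<close>)
qed

lemma completion_constant:
  assumes "\<And>i. i \<in> set \<pi> \<Longrightarrow> p i = c" "distinct \<pi>" "i < length \<pi>"
  shows "completion p \<pi> (\<pi> ! i) = c * (real i + 1)"
proof -
  \<comment> \<open>The jobs are distinct, so exactly \<open>i\<close> of them precede the one at
    position \<open>i\<close>; the \<open>+ 1\<close> in the claim is that job itself.\<close>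
  have "takeWhile (\<lambda>k. k \<noteq> \<pi> ! i) \<pi> = take i \<pi>"
    using assms(2,3) by (intro takeWhile_eq_take_P_nth) (auto simp: nth_eq_iff_index_eq)
  moreover have "map p (take i \<pi>) = replicate i c"
    using assms by (intro replicate_eqI) (auto dest: in_set_takeD)
  ultimately show ?thesis
    using assms by (simp add: completion_def sum_list_replicate algebra_simps)
qed

text \<open>With equal processing times and due dates the schedules only permute the completion times.\<close>

lemma cost_constant:
  assumes p: "\<And>i. i < n \<Longrightarrow> p i = c" and d: "\<And>i. i < n \<Longrightarrow> d i = e"
    and \<pi>: "\<pi> \<in> permutations_of_set {..<n}"
  shows "cost \<gamma> (\<lambda>_. 1) p d \<pi> = cost \<gamma> (\<lambda>_. 1) (\<lambda>_. c) (\<lambda>_. e) [0..<n]"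
proof -
  have set: "set \<pi> = {..<n}" and dis: "distinct \<pi>"
    using \<pi> by (auto simp: permutations_of_set_def)
  then have len: "length \<pi> = n"
    by (metis card_lessThan distinct_card)
  have bij: "bij_betw ((!) \<pi>) {..<n} (set \<pi>)"
    using bij_betw_nth[OF dis] len by auto
  have C: "completion p \<pi> (\<pi> ! i) = completion (\<lambda>_. c) [0..<n] i" if "i < n" for i
    using completion_constant[of \<pi> p c i] completion_constant[of "[0..<n]" "\<lambda>_. c" c i]
      p dis set len that by auto
  have d': "d (\<pi> ! i) = e" if "i < n" for i
    using d set len that nth_mem by blast
  \<comment> \<open>Sums and maxima over jobs are rewritten over positions, where the completion
    times no longer depend on \<open>\<pi>\<close>.\<close>
  have "(\<Sum>j\<in>set \<pi>. h j) = (\<Sum>i<n. h (\<pi> ! i))" for h :: "nat \<Rightarrow> real"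
    by (rule sum.reindex_bij_betw[OF bij, symmetric])
  moreover have "h ` set \<pi> = (\<lambda>i. h (\<pi> ! i)) ` {..<n}" for h :: "nat \<Rightarrow> real"
    using bij by (metis bij_betw_imp_surj_on image_image)
  ultimately show ?thesis
    using C d' by (cases \<gamma>) (simp_all add: tardiness_def late_def atLeast0LessThan cong: image_cong_simp)
qed

section \<open>Risk measures\<close>

lemma expectation_pmf_of_list:
  fixes h :: "'a \<Rightarrow> real"
  assumes "pmf_of_list_wf xs"
  shows "measure_pmf.expectation (pmf_of_list xs) h = (\<Sum>(x, q)\<leftarrow>xs. q * h x)"
proof -
  \<comment> \<open>Equal outcomes may occur several times in the list, so the weights are collected
    per outcome. The set \<open>A\<close> is kept general because the tail of a list may have fewer
    outcomes.\<close>
  have aux: "(\<Sum>a\<in>A. h a * sum_list (map snd (filter (\<lambda>z. fst z = a) ys))) = (\<Sum>(x, q)\<leftarrow>ys. q * h x)"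
    if "fst ` set ys \<subseteq> A" "finite A" for A and ys :: "('a \<times> real) list"
    using that(1)
  proof (induction ys)
    case (Cons y ys)
    have "(\<Sum>a\<in>A. h a * sum_list (map snd (filter (\<lambda>z. fst z = a) (y # ys)))) =
        (\<Sum>a\<in>A. (if a = fst y then h a * snd y else 0) +
           h a * sum_list (map snd (filter (\<lambda>z. fst z = a) ys)))"
      by (intro sum.cong) (auto simp: algebra_simps)
    then show ?case
      using Cons that(2) by (simp add: sum.distrib sum.delta case_prod_beta mult.commute)
  qed simp
  have "measure_pmf.expectation (pmf_of_list xs) h =
      (\<Sum>a\<in>fst ` set xs. h a * pmf (pmf_of_list xs) a)"
    using set_pmf_of_list[OF assms] by (intro integral_measure_pmf_real) auto
  also have "\<dots> = (\<Sum>(x, q)\<leftarrow>xs. q * h x)"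
    using aux[of xs "fst ` set xs"] by (simp add: pmf_pmf_of_list[OF assms])
  finally show ?thesis .
qed

text \<open>The additional outcome \<open>M\<close> dominates all others and has probability \<open>1 - a\<close>, less than the tail
  mass \<open>1 - \<alpha>\<close>, but together with any single other outcome it exceeds the tail mass.\<close>

locale dominated_outcomes =
  fixes fs :: "real list" and M a \<alpha> :: real and K :: nat
  assumes K: "length fs = K" "K > 0"
    and M: "\<And>f. f \<in> set fs \<Longrightarrow> f \<le> M"
    and a: "0 < \<alpha>" "\<alpha> < a" "a < 1" "a - a / K < \<alpha>"
begin

definition "outcomes = zip fs (replicate K (a / K)) @ [(M, 1 - a)]"

abbreviation "Y \<equiv> pmf_of_list outcomes"
abbreviation "m \<equiv> Max (set fs)"

lemma outcomes_eq: "outcomes = map (\<lambda>f. (f, a / K)) fs @ [(M, 1 - a)]"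
  using K by (simp add: outcomes_def zip_replicate2)

lemma outcomes_wf: "pmf_of_list_wf outcomes"
  unfolding pmf_of_list_wf_def outcomes_eq using a K
  by (auto simp: comp_def map_replicate_const sum_list_replicate)

lemma m: "m \<in> set fs" "\<And>f. f \<in> set fs \<Longrightarrow> f \<le> m"
  using K by auto

lemma prob_le:
  "measure_pmf.prob Y {..t} =
     length (filter (\<lambda>f. f \<le> t) fs) * (a / K) + (if M \<le> t then 1 - a else 0)"
  by (subst measure_pmf_of_list[OF outcomes_wf])
     (simp add: outcomes_eq filter_map comp_def map_replicate_const sum_list_replicate)

text \<open>The level \<open>\<alpha>\<close> is reached exactly when no old outcome lies above
  \<open>t\<close>: together they have mass \<open>a > \<alpha>\<close>, while missing one leaves at
  most \<open>a - a / K < \<alpha>\<close>.\<close>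

lemma VaR_eq: "VaR \<alpha> Y = m"
proof -
  have "measure_pmf.prob Y {..t} \<ge> \<alpha> \<longleftrightarrow> m \<le> t" for t
  proof (cases "m \<le> t")
    case True
    then have "filter (\<lambda>f. f \<le> t) fs = fs"
      by (subst filter_id_conv) (meson order_trans m(2))
    then show ?thesis
      using True a K by (simp add: prob_le)
  next
    case False
    \<comment> \<open>Since \<open>t < m \<le> M\<close>, the added outcome contributes
      nothing.\<close>
    then have "\<not> M \<le> t" using M[OF m(1)] by simp
    have "length (filter (\<lambda>f. f \<le> t) fs) < K"
      using length_filter_less[OF m(1), of "\<lambda>f. f \<le> t"] False K by simp
    then have "real (length (filter (\<lambda>f. f \<le> t) fs)) * (a / K) \<le> (real K - 1) * (a / K)"
      using a by (intro mult_right_mono) auto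
    also have "\<dots> = a - a / K"
      using K by (simp add: field_simps)
    finally show ?thesis
      using False a \<open>\<not> M \<le> t\<close> by (simp add: prob_le)
  qed
  then have "{t. measure_pmf.prob Y {..t} \<ge> \<alpha>} = {m..}" by auto
  then show ?thesis by (simp add: VaR_def)
qed

text \<open>The infimum is attained at \<open>\<gamma> = m\<close>. Up to the factor
  \<open>1 / (1 - \<alpha>)\<close>, the function rises above its value there at rate at least
  \<open>a - \<alpha>\<close> to the right and \<open>\<alpha> - (a - a / K)\<close> to the
  left.\<close>

lemma CVaR_eq: "CVaR \<alpha> Y = (1 - a) / (1 - \<alpha>) * M + (a - \<alpha>) / (1 - \<alpha>) * m"
proof -
  define E where "E \<gamma> = measure_pmf.expectation Y (\<lambda>y. max 0 (y - \<gamma>))" for \<gamma>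
  have E: "E \<gamma> = (\<Sum>f\<leftarrow>fs. (a / K) * max 0 (f - \<gamma>)) + (1 - a) * max 0 (M - \<gamma>)" for \<gamma>
    unfolding E_def expectation_pmf_of_list[OF outcomes_wf] by (simp add: outcomes_eq comp_def)
  have "(\<Sum>f\<leftarrow>fs. (a / K) * max 0 (f - m)) = (\<Sum>f\<leftarrow>fs. 0)"
    using m(2) by (intro arg_cong[where f = sum_list] map_cong) auto
  then have Em: "E m = (1 - a) * (M - m)"
    using M[OF m(1)] by (simp add: E)
  \<comment> \<open>Keeps only a worst old outcome and the added one; on either side of
    \<open>m\<close> this bound is linear in \<open>\<gamma>\<close>.\<close>
  have ge: "E \<gamma> \<ge> (a / K) * max 0 (m - \<gamma>) + (1 - a) * (M - \<gamma>)" for \<gamma>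
  proof -
    have "(a / K) * max 0 (m - \<gamma>) \<le> (\<Sum>f\<leftarrow>fs. (a / K) * max 0 (f - \<gamma>))"
      using m(1) a by (intro member_le_sum_list) (auto intro!: mult_nonneg_nonneg)
    moreover have "(1 - a) * (M - \<gamma>) \<le> (1 - a) * max 0 (M - \<gamma>)"
      using a by (intro mult_left_mono) auto
    ultimately show ?thesis by (simp add: E)
  qed
  have "m + 1 / (1 - \<alpha>) * E m \<le> \<gamma> + 1 / (1 - \<alpha>) * E \<gamma>" for \<gamma>
  proof -
    have "(1 - \<alpha>) * m + (1 - a) * (M - m) \<le>
        (1 - \<alpha>) * \<gamma> + ((a / K) * max 0 (m - \<gamma>) + (1 - a) * (M - \<gamma>))"
    proof (cases "m \<le> \<gamma>")
      case True
      then have "0 \<le> (a - \<alpha>) * (\<gamma> - m)" using a by simp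
      with True show ?thesis by (simp add: algebra_simps)
    next
      case False
      then have "0 \<le> (\<alpha> - (a - a / K)) * (m - \<gamma>)" using a by simp
      with False show ?thesis by (simp add: algebra_simps)
    qed
    also have "\<dots> \<le> (1 - \<alpha>) * \<gamma> + E \<gamma>"
      using ge by simp
    finally have "((1 - \<alpha>) * m + E m) / (1 - \<alpha>) \<le> ((1 - \<alpha>) * \<gamma> + E \<gamma>) / (1 - \<alpha>)"
      using a by (intro divide_right_mono) (auto simp: Em)
    then show ?thesis
      using a by (simp add: add_divide_distrib)
  qed
  then have "CVaR \<alpha> Y = m + 1 / (1 - \<alpha>) * E m"
    unfolding CVaR_def E_def by (intro cInf_eq_minimum) auto
  also have "\<dots> = ((1 - \<alpha>) * m + E m) / (1 - \<alpha>)"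
    using a by (simp add: add_divide_distrib)
  also have "(1 - \<alpha>) * m + E m = (1 - a) * M + (a - \<alpha>) * m"
    by (simp add: Em algebra_simps)
  also have "\<dots> / (1 - \<alpha>) = (1 - a) / (1 - \<alpha>) * M + (a - \<alpha>) / (1 - \<alpha>) * m"
    by (simp add: add_divide_distrib)
  finally show ?thesis .
qed

end

section \<open>The reduction\<close>

definition added_scenario :: "problem \<Rightarrow> uncertain_instance \<Rightarrow> scenario" where
  "added_scenario P I =
     replicate (njobs I) (2 ^ pad_length (unit_times P) (enc_uncertain I), 0)"

definition risk_instance :: "problem \<Rightarrow> rat \<Rightarrow> uncertain_instance \<Rightarrow> stochastic_instance" where
  "risk_instance P a I =
     (I\<lparr>scenarios := scenarios I @ [added_scenario P I]\<rparr>,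
      replicate (length (scenarios I)) (a / of_nat (length (scenarios I))) @ [1 - a])"

definition risk_word :: "problem \<Rightarrow> nat \<Rightarrow> rat \<Rightarrow> word \<Rightarrow> word" where
  "risk_word P K a = append_scenario_word (unit_times P)
     (enc_list enc_rat (replicate K (a / of_nat K) @ [1 - a]))"

lemma enc_job: "enc_rat (2 ^ k) @ enc_rat 0 = job_word k"
proof -
  have "quotient_of (2 ^ k) = (2 ^ k, 1)"
    using quotient_of_rat_of_int[of "2 ^ k"] by simp
  moreover have "bits 1 = [True]" "bits 0 = []"
    using bits_two_power[of 0] by (simp_all add: bits.simps[of 0])
  ultimately show ?thesis
    by (simp add: enc_rat_def enc_nat_def bits_two_power job_word_def nat_power_eq)
qed

lemma takeWhile_dropWhile_replicate:
  assumes "b \<noteq> c"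
  shows "takeWhile (\<lambda>a. a = b) (replicate n b @ c # w) = replicate n b"
    and "dropWhile (\<lambda>a. a = b) (replicate n b @ c # w) = c # w"
  using assms by (induction n) auto

lemma enc_uncertain_prefix:
  "takeWhile (\<lambda>a. a = Digit True) (enc_uncertain I) = replicate (njobs I) (Digit True)"
  "dropWhile (\<lambda>a. a = Digit True) (enc_uncertain I) = Sep #
     enc_list (\<lambda>(i, j). enc_nat i @ enc_nat j) (precs I) @
     enc_list (enc_list (\<lambda>(p, d). enc_rat p @ enc_rat d)) (scenarios I)"
  by (simp_all add: enc_uncertain_def takeWhile_dropWhile_replicate)

text \<open>The probabilities depend only on \<open>K\<close> and \<open>a\<close>, hence the
  constant prefix. The scenarios come last in the encoding, so a new one goes before the final
  bracket.\<close>

lemma enc_risk_instance: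
  assumes "length (scenarios I) = K"
  shows "enc_stochastic (risk_instance P a I) = risk_word P K a (enc_uncertain I)"
  by (simp add: assms risk_instance_def risk_word_def append_scenario_word_def enc_stochastic_def
      enc_uncertain_prefix(1) added_scenario_def)
     (simp add: enc_uncertain_def enc_list_def butlast_append enc_job)

lemma length_le_length_enc_list: "x \<in> set xs \<Longrightarrow> length (e x) \<le> length (enc_list e xs)"
proof -
  assume "x \<in> set xs"
  then have "length (e x) \<le> sum_list (map (length \<circ> e) xs)"
    by (intro member_le_sum_list) auto
  then show ?thesis
    by (simp add: enc_list_def length_concat)
qed

text \<open>The denominator is at least 1, so the numerator bounds \<open>r\<close>, and the binary
  digits of the numerator are part of the encoding.\<close>

lemma le_two_power_enc_rat: "r \<le> 2 ^ length (enc_rat r)"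
proof -
  define n where "n = nat (fst (quotient_of r))"
  have pos: "snd (quotient_of r) > 0" by (rule quotient_of_denom_pos')
  have "r = of_int (fst (quotient_of r)) / of_int (snd (quotient_of r))"
    by (rule quotient_of_div) simp
  \<comment> \<open>Truncating a negative numerator to 0 only increases the quotient.\<close>
  also have "\<dots> \<le> rat_of_nat n / of_int (snd (quotient_of r))"
    using pos by (intro divide_right_mono) (auto simp: n_def)
  also have "\<dots> \<le> rat_of_nat n / 1"
    using pos by (intro divide_left_mono) auto
  also have "\<dots> \<le> rat_of_nat (2 ^ length (enc_rat r))"
  proof -
    have "n < 2 ^ length (bits n)" by (rule less_two_power_length_bits)
    also have "\<dots> \<le> 2 ^ length (enc_rat r)"
      by (intro power_increasing) (auto simp: enc_rat_def enc_nat_def n_def)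
    finally show ?thesis by (simp only: div_by_1 of_nat_le_iff less_imp_le)
  qed
  finally show ?thesis by simp
qed

text \<open>The encoding of \<open>p\<close> is part of what follows the unary number of jobs, so
  its length is at most the exponent. With unit times both sides are 1.\<close>

lemma processing_time_bound:
  assumes "I \<in> uncertain_instances P K" "\<xi> \<in> set (scenarios I)" "(p, d) \<in> set \<xi>"
  shows "p \<le> 2 ^ pad_length (unit_times P) (enc_uncertain I)"
proof (cases "unit_times P")
  case True
  then show ?thesis
    using assms by (auto simp: uncertain_instances_def valid_scenario_def pad_length_def)
next
  case False
  let ?e = "\<lambda>(p, d). enc_rat p @ enc_rat d"
  have "length (enc_rat p) \<le> length (?e (p, d))" by simp
  also have "\<dots> \<le> length (enc_list ?e \<xi>)"
    by (rule length_le_length_enc_list) fact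
  also have "\<dots> \<le> length (enc_list (enc_list ?e) (scenarios I))"
    by (rule length_le_length_enc_list) fact
  also have "\<dots> \<le> pad_length (unit_times P) (enc_uncertain I)"
    using False by (simp add: pad_length_def enc_uncertain_prefix)
  finally have "(2 :: rat) ^ length (enc_rat p) \<le> 2 ^ pad_length (unit_times P) (enc_uncertain I)"
    by (intro power_increasing) auto
  with le_two_power_enc_rat[of p] show ?thesis by (rule order_trans)
qed

lemma risk_instance_in:
  assumes "I \<in> uncertain_instances P K" "0 < a" "a < 1" "K > 0"
  shows "risk_instance P a I \<in> stochastic_instances P (K + 1)"
proof -
  have "valid_scenario P (njobs I) (added_scenario P I)"
    by (auto simp: valid_scenario_def added_scenario_def pad_length_def)
  then show ?thesis
    using assms
    by (auto simp: risk_instance_def stochastic_instances_def uncertain_instances_def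
        sum_list_replicate)
qed

section \<open>Schedules and costs of the constructed instance\<close>

lemma schedules_risk_instance: "schedules (fst (risk_instance P a I)) = schedules I"
  by (simp add: schedules_def risk_instance_def)

text \<open>The order \<open>[0..<njobs I]\<close> may violate the precedence constraints; it merely
  represents the cost shared by all permutations.\<close>

definition added_cost :: "problem \<Rightarrow> uncertain_instance \<Rightarrow> real" where
  "added_cost P I = cost (criterion_of P) (\<lambda>_. 1)
     (\<lambda>_. 2 ^ pad_length (unit_times P) (enc_uncertain I)) (\<lambda>_. 0) [0..<njobs I]"

lemma added_cost:
  assumes "\<pi> \<in> schedules I"
  shows "unit_weight_cost P \<pi> (added_scenario P I) = added_cost P I"
  unfolding unit_weight_cost_def added_cost_def
  by (rule cost_constant)
     (use assms in \<open>auto simp: schedules_def ptime_def ddate_def added_scenario_def of_rat_power\<close>)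

text \<open>The added scenario is extreme in both data: its processing times are an upper bound, and
  its due dates have the least admissible value 0.\<close>

lemma cost_le_added_cost:
  assumes I: "I \<in> uncertain_instances P K" and \<xi>: "\<xi> \<in> set (scenarios I)" and \<pi>: "\<pi> \<in> schedules I"
  shows "unit_weight_cost P \<pi> \<xi> \<le> added_cost P I"
proof -
  have set: "set \<pi> = {..<njobs I}"
    using \<pi> by (simp add: schedules_def permutations_of_set_def)
  have valid: "valid_scenario P (njobs I) \<xi>" and n: "njobs I > 0"
    using I \<xi> by (simp_all add: uncertain_instances_def)
  then have len: "length \<xi> = njobs I"
    by (simp add: valid_scenario_def)
  have "unit_weight_cost P \<pi> \<xi> \<le> unit_weight_cost P \<pi> (added_scenario P I)"
    unfolding unit_weight_cost_def
  proof (rule cost_mono)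
    fix i assume "i \<in> set \<pi>"
    then have i: "i < njobs I" by (simp add: set)
    then have mem: "(fst (\<xi> ! i), snd (\<xi> ! i)) \<in> set \<xi>"
      using len by simp
    have nth: "added_scenario P I ! i = (2 ^ pad_length (unit_times P) (enc_uncertain I), 0)"
      using i by (simp add: added_scenario_def)
    show "ptime \<xi> i \<le> ptime (added_scenario P I) i"
      unfolding ptime_def nth fst_conv of_rat_less_eq by (rule processing_time_bound[OF I \<xi> mem])
    have "0 \<le> snd (\<xi> ! i)"
      using valid mem unfolding valid_scenario_def by blast
    then show "ddate (added_scenario P I) i \<le> ddate \<xi> i"
      by (simp add: ddate_def nth)
  next
    have "0 \<in> set \<pi>" using n by (simp only: set lessThan_iff)
    then show "\<pi> \<noteq> []" by (metis empty_iff empty_set)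
  qed
  then show ?thesis using added_cost[OF \<pi>] by simp
qed

context
  fixes P :: problem and K :: nat and a :: rat and \<alpha> :: real
  assumes K: "K > 0" and a: "0 < \<alpha>" "\<alpha> < of_rat a" "of_rat a < (1 :: real)"
    "of_rat a - of_rat a / real K < \<alpha>"
begin

lemma rat_bounds: "0 < a" "a < 1"
proof -
  have "(0 :: real) < of_rat a" using a by linarith
  then show "0 < a" by simp
  show "a < 1" using a(3) by simp
qed

lemma objective_risk_instance:
  assumes I: "I \<in> uncertain_instances P K" and \<pi>: "\<pi> \<in> schedules I"
  defines "m \<equiv> objective (Min_Max P K) I \<pi>"
  shows "objective (Min_VaR \<alpha> P (K + 1)) (risk_instance P a I) \<pi> = m"
    and "objective (Min_CVaR \<alpha> P (K + 1)) (risk_instance P a I) \<pi> =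
      (1 - of_rat a) / (1 - \<alpha>) * added_cost P I + (of_rat a - \<alpha>) / (1 - \<alpha>) * m"
proof -
  define fs where "fs = map (unit_weight_cost P \<pi>) (scenarios I)"
  interpret dominated_outcomes fs "added_cost P I" "of_rat a" \<alpha> K
    using I K a cost_le_added_cost[OF I _ \<pi>]
    by unfold_locales (auto simp: fs_def uncertain_instances_def)
  have len: "length (scenarios I) = K"
    using I by (simp add: uncertain_instances_def)
  have "random_cost P (risk_instance P a I) \<pi> = Y"
    unfolding outcomes_def random_cost_def using len
    by (simp add: risk_instance_def fs_def added_cost[OF \<pi>] of_rat_divide of_rat_diff)
  moreover have "m = Max (set fs)"
    by (simp add: m_def Min_Max_def fs_def)
  ultimately show "objective (Min_VaR \<alpha> P (K + 1)) (risk_instance P a I) \<pi> = m"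
    "objective (Min_CVaR \<alpha> P (K + 1)) (risk_instance P a I) \<pi> =
      (1 - of_rat a) / (1 - \<alpha>) * added_cost P I + (of_rat a - \<alpha>) / (1 - \<alpha>) * m"
    using VaR_eq CVaR_eq by (simp_all add: Min_VaR_def Min_CVaR_def Min_Risk_def)
qed

end

section \<open>Transfer of answers\<close>

text \<open>Solutions and their encodings are shared, so answers pass unchanged. The values are
  related by an increasing affine map whose offset may depend on the instance but not on the
  solution.\<close>

locale affine_reduction =
  fixes A :: "('i, 's) min_problem" and B :: "('j, 's) min_problem"
    and f :: "word \<Rightarrow> word" and F :: "'i \<Rightarrow> 'j" and c :: "'i \<Rightarrow> real" and k :: real
  assumes k: "k > 0"
    and F: "\<And>I. I \<in> instances A \<Longrightarrow> F I \<in> instances B"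
    and enc: "\<And>I. I \<in> instances A \<Longrightarrow> enc_instance B (F I) = f (enc_instance A I)"
    and inj: "inj_on (enc_instance B) (instances B)"
    and solutions: "\<And>I. I \<in> instances A \<Longrightarrow> solutions B (F I) = solutions A I"
    and finite: "\<And>I. I \<in> instances A \<Longrightarrow> finite (solutions A I)"
    and enc_solution: "enc_solution B = enc_solution A"
    and obj: "\<And>I S. I \<in> instances A \<Longrightarrow> S \<in> solutions A I \<Longrightarrow>
      objective B (F I) S = c I + k * objective A I S"
begin

lemma opt_value_eq:
  assumes "I \<in> instances A" "solutions A I \<noteq> {}"
  shows "opt_value B (F I) = c I + k * opt_value A I"
proof -
  have "mono (\<lambda>x. c I + k * x)"
    using k by (auto simp: mono_def)
  then have "c I + k * Min (objective A I ` solutions A I) =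
      Min ((\<lambda>x. c I + k * x) ` objective A I ` solutions A I)"
    using assms finite by (intro mono_Min_commute) auto
  also have "(\<lambda>x. c I + k * x) ` objective A I ` solutions A I = objective B (F I) ` solutions B (F I)"
    using assms obj solutions by (auto simp: image_image)
  finally show ?thesis by (simp add: opt_value_def)
qed

lemma instance_unique:
  "I \<in> instances A \<Longrightarrow> J \<in> instances B \<Longrightarrow> f (enc_instance A I) = enc_instance B J \<Longrightarrow> J = F I"
  using inj F enc by (metis inj_onD)

lemma optimal_answer_iff:
  assumes "I \<in> instances A" "S \<in> solutions A I"
  shows "objective B (F I) S = opt_value B (F I) \<longleftrightarrow> objective A I S = opt_value A I"
proof -
  have "solutions A I \<noteq> {}" using assms by blast
  then show ?thesis using k by (simp add: obj opt_value_eq assms)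
qed

lemma solves_optimal:
  assumes "solves g (optimal_answer B)"
  shows "solves (\<lambda>x. g (f x)) (optimal_answer A)"
  unfolding solves_def
proof clarify
  fix x y assume "optimal_answer A x y"
  then obtain I S where I: "I \<in> instances A" "S \<in> solutions A I" "x = enc_instance A I"
      "objective A I S = opt_value A I"
    by (auto simp: optimal_answer_def)
  \<comment> \<open>\<open>solves\<close> binds \<open>g\<close> only on words that have some
    answer, so one is exhibited for \<open>f x\<close>.\<close>
  then have "optimal_answer B (f x) (enc_solution B S)"
    unfolding optimal_answer_def using F enc solutions optimal_answer_iff by metis
  then have "optimal_answer B (f x) (g (f x))"
    using assms by (auto simp: solves_def)
  then obtain J S' where J: "J \<in> instances B" "S' \<in> solutions B J" "f x = enc_instance B J"
      "g (f x) = enc_solution B S'" "objective B J S' = opt_value B J"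
    by (auto simp: optimal_answer_def)
  then have "J = F I"
    using I instance_unique by blast
  then show "optimal_answer A x (g (f x))"
    unfolding optimal_answer_def using I J solutions optimal_answer_iff enc_solution by metis
qed

text \<open>Without an offset both sides of the approximation guarantee scale by \<open>k\<close>.
  The value at risk fits this; for the conditional value at risk the added scenario contributes an
  offset.\<close>

lemma approx_answer:
  assumes ck: "\<And>I. c I = 0" and "approx_answer \<rho> A x y"
  shows "\<exists>y'. approx_answer \<rho> B (f x) y'"
    and "approx_answer \<rho> B (f x) y' \<Longrightarrow> approx_answer \<rho> A x y'"
proof -
  have iff: "objective B (F I) S \<le> \<rho> * opt_value B (F I) \<longleftrightarrow> objective A I S \<le> \<rho> * opt_value A I"
    if "I \<in> instances A" "S \<in> solutions A I" for I S
  proof -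
    have "solutions A I \<noteq> {}" using that by blast
    then have "objective B (F I) S \<le> \<rho> * opt_value B (F I) \<longleftrightarrow>
        k * objective A I S \<le> k * (\<rho> * opt_value A I)"
      by (simp add: that obj opt_value_eq ck mult.left_commute)
    then show ?thesis using k by simp
  qed
  obtain I S where I: "I \<in> instances A" "S \<in> solutions A I" "x = enc_instance A I"
      "objective A I S \<le> \<rho> * opt_value A I"
    using assms(2) by (auto simp: approx_answer_def)
  then have "approx_answer \<rho> B (f x) (enc_solution B S)"
    unfolding approx_answer_def using F enc solutions iff by metis
  then show "\<exists>y'. approx_answer \<rho> B (f x) y'" ..
  assume "approx_answer \<rho> B (f x) y'"
  then obtain J S' where J: "J \<in> instances B" "S' \<in> solutions B J" "f x = enc_instance B J"
      "y' = enc_solution B S'" "objective B J S' \<le> \<rho> * opt_value B J"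
    by (auto simp: approx_answer_def)
  then have "J = F I"
    using I instance_unique by blast
  then show "approx_answer \<rho> A x y'"
    unfolding approx_answer_def using I J solutions iff enc_solution by metis
qed

end

section \<open>The reductions to value at risk and conditional value at risk\<close>

lemma affine_reduction_risk:
  fixes P :: problem and K :: nat and a :: rat and \<alpha> :: real
  assumes K: "K > 0" and a: "0 < \<alpha>" "\<alpha> < of_rat a" "of_rat a < (1 :: real)"
    "of_rat a - of_rat a / real K < \<alpha>"
  shows "affine_reduction (Min_Max P K) (Min_VaR \<alpha> P (K + 1)) (risk_word P K a) (risk_instance P a)
      (\<lambda>_. 0) 1"
    and "affine_reduction (Min_Max P K) (Min_CVaR \<alpha> P (K + 1)) (risk_word P K a) (risk_instance P a)
      (\<lambda>I. (1 - of_rat a) / (1 - \<alpha>) * added_cost P I) ((of_rat a - \<alpha>) / (1 - \<alpha>))"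
proof -
  note obj = objective_risk_instance[OF assms]
  have fin: "finite (schedules I)" for I
    by (rule finite_subset[of _ "permutations_of_set {..<njobs I}"]) (auto simp: schedules_def)
  have inst: "instances (Min_Max P K) = uncertain_instances P K"
    "solutions (Min_Max P K) = schedules" "enc_instance (Min_Max P K) = enc_uncertain"
    "enc_solution (Min_Max P K) = enc_list enc_nat"
    by (simp_all add: Min_Max_def)
  have len: "length (scenarios I) = K" if "I \<in> uncertain_instances P K" for I
    using that by (simp add: uncertain_instances_def)
  note rb = rat_bounds[OF assms]
  \<comment> \<open>Positive because \<open>\<alpha> < a < 1\<close>: the tail includes a part of
    the worst old outcome.\<close>
  have slope: "(of_rat a - \<alpha>) / (1 - \<alpha>) > 0"
    using a by (intro divide_pos_pos) linarith+
  show "affine_reduction (Min_Max P K) (Min_VaR \<alpha> P (K + 1)) (risk_word P K a) (risk_instance P a)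
      (\<lambda>_. 0) 1"
    by unfold_locales
      (use obj(1) fin risk_instance_in[OF _ rb K] enc_risk_instance[OF len] inj_on_enc_stochastic in
        \<open>simp_all only: inst, simp_all add: Min_VaR_def Min_Risk_def schedules_risk_instance\<close>)
  show "affine_reduction (Min_Max P K) (Min_CVaR \<alpha> P (K + 1)) (risk_word P K a) (risk_instance P a)
      (\<lambda>I. (1 - of_rat a) / (1 - \<alpha>) * added_cost P I) ((of_rat a - \<alpha>) / (1 - \<alpha>))"
    by unfold_locales
      (use slope obj(2) fin risk_instance_in[OF _ rb K] enc_risk_instance[OF len] inj_on_enc_stochastic in
        \<open>simp_all only: inst, simp_all add: Min_CVaR_def Min_Risk_def schedules_risk_instance\<close>)
qed

text \<open>The last condition says \<open>a < \<alpha> * K / (K - 1)\<close>, and this bound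
  exceeds \<open>\<alpha>\<close>. The probabilities of an instance are rational while
  \<open>\<alpha>\<close> may be any real, so \<open>a\<close> is taken from a dense set.\<close>

lemma exists_total_probability:
  fixes \<alpha> :: real
  assumes "K \<ge> 2" "0 < \<alpha>" "\<alpha> < 1"
  obtains a :: rat where "\<alpha> < of_rat a" "of_rat a < (1 :: real)"
    "of_rat a - of_rat a / real K < \<alpha>"
proof -
  have "\<alpha> < \<alpha> * real K / (real K - 1)"
    using assms by (simp add: field_simps)
  then obtain a where a: "\<alpha> < of_rat a" "of_rat a < min 1 (\<alpha> * real K / (real K - 1))"
    using assms of_rat_dense[of \<alpha> "min 1 (\<alpha> * real K / (real K - 1))"] by auto
  then have "of_rat a * (real K - 1) < \<alpha> * real K"
    using assms by (simp add: field_simps)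
  then have "of_rat a - of_rat a / real K < \<alpha>"
    using assms by (simp add: field_simps)
  with a that show ?thesis by auto
qed

theorem theorem2:
  fixes P :: problem and K :: nat and \<rho> :: real
  assumes "K \<ge> 2" and "\<rho> > 1"
    and "NP_hard (Min_Max P K)"
    and "hard_to_approximate \<rho> (Min_Max P K)"
  shows "(\<forall>\<alpha>. 0 < \<alpha> \<and> \<alpha> < 1 \<longrightarrow>
            NP_hard (Min_VaR \<alpha> P (K + 1)) \<and> hard_to_approximate \<rho> (Min_VaR \<alpha> P (K + 1))) \<and>
         (\<forall>\<alpha>. 0 < \<alpha> \<and> \<alpha> < 1 \<longrightarrow> NP_hard (Min_CVaR \<alpha> P (K + 1)))"
proof -
  have "NP_hard (Min_VaR \<alpha> P (K + 1)) \<and> hard_to_approximate \<rho> (Min_VaR \<alpha> P (K + 1)) \<and>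
      NP_hard (Min_CVaR \<alpha> P (K + 1))" if \<alpha>: "0 < \<alpha>" "\<alpha> < 1" for \<alpha> :: real
  proof -
    obtain a where a: "\<alpha> < of_rat a" "of_rat a < (1 :: real)" "of_rat a - of_rat a / real K < \<alpha>"
      using exists_total_probability[OF assms(1) \<alpha>] .
    have "K > 0" using assms(1) by simp
    note red = affine_reduction_risk[OF this \<alpha>(1) a, of P]
    \<comment> \<open>The flag and the prefix depend on \<open>P\<close>, \<open>K\<close> and
      \<open>a\<close> only, so one fixed program serves all inputs.\<close>
    note program = computes_in_place_append_scenario length_append_scenario_word
    note program = program[of "unit_times P"
        "enc_list enc_rat (replicate K (a / of_nat K) @ [1 - a])", folded risk_word_def]
    have "NP_hard (Min_VaR \<alpha> P (K + 1))"
      by (rule NP_hard_transfer[OF assms(3) program affine_reduction.solves_optimal[OF red(1)]])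
    moreover have "NP_hard (Min_CVaR \<alpha> P (K + 1))"
      by (rule NP_hard_transfer[OF assms(3) program affine_reduction.solves_optimal[OF red(2)]])
    moreover have "hard_to_approximate \<rho> (Min_VaR \<alpha> P (K + 1))"
      unfolding hard_to_approximate_def
    proof (intro impI notI)
      assume "class_P \<noteq> class_NP" and "polytime_solvable (approx_answer \<rho> (Min_VaR \<alpha> P (K + 1)))"
      from this(2) have "polytime_solvable (approx_answer \<rho> (Min_Max P K))"
        by (rule polytime_solvable_transfer[OF _ program])
           (rule affine_reduction.approx_answer[OF red(1) refl]; assumption)+
      with \<open>class_P \<noteq> class_NP\<close> assms(4) show False
        by (simp add: hard_to_approximate_def)
    qed
    ultimately show ?thesis by blast
  qed
  then show ?thesis by blast
qed

end
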